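(* Let $H$, $J$, $A$ and the Dirac operator $D=D_0+D_1+D_R$ be as in the context, and suppose $\delta_{12}=\delta_{13}=\delta_{14}=\beta_{13}=\beta_{14}=\alpha_{13}=\alpha_{14}=0$. Then the Hodge property $\mathcal{C}\ell_D(A)'=\mathcal{C}\ell_D(A)^\circ$ holds if and only if $\delta_{21}\neq 0$ and none of the three vectors $(\alpha_{23},\alpha_{24})$, $(\beta_{23},\beta_{24})$, $(\delta_{22},\delta_{23},\delta_{24})$ is zero.
   Context: Let $H=M_4(\mathbb{C})\oplus M_4(\mathbb{C})$, with elements written as pairs $(v,w)$ and inner product $\langle (v,w),(v',w')\rangle=\mathrm{Tr}(v^*v')+\mathrm{Tr}(w^*w')$. Let $J$ be the antilinear isometry $J(v,w)=(w^*,v^* )$. Identify $\mathrm{End}_{\mathbb{C}}(H)$ with $M_4(\mathbb{C})\otimes M_2(\mathbb{C})\otimes M_4(\mathbb{C})$ via $\big(x\otimes\begin{bmatrix}a&b\\c&d\end{bmatrix}\otimes y\big)(v,w)=\big(x(av+bw)y^t,\ x(cv+dw)y^t\big)$. Here $e_{ij}$ denotes the matrix unit with $1$ in position $(i,j)$ (size clear from context) and $1$ the identity matrix. Let $A\cong\mathbb{C}\oplus\mathbb{H}\oplus M_3(\mathbb{C})$ be the real $*$-algebra of operators $\mathrm{diag}(\lambda,\bar\lambda,q)\otimes e_{11}\otimes 1+\mathrm{diag}(\lambda,m)\otimes e_{22}\otimes 1$, where $\lambda\in\mathbb{C}$, $q$ is a quaternion viewed as a $2\times 2$ complex matrix $\begin{bmatrix}z&w\\-\bar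 w&\bar z\end{bmatrix}$, $m\in M_3(\mathbb{C})$, and $\mathrm{diag}$ denotes block-diagonal $4\times4$ matrices. Fix complex parameters $\alpha_{ij},\beta_{ij}$ ($i\in\{1,2\}$, $j\in\{3,4\}$), $\delta_{12},\delta_{13},\delta_{14},\delta_{21},\delta_{22},\delta_{23},\delta_{24}$ and $\Upsilon_R$. Put $\alpha=\begin{bmatrix}\alpha_{13}&\alpha_{14}\\ \alpha_{23}&\alpha_{24}\end{bmatrix}$, $\beta=\begin{bmatrix}\beta_{13}&\beta_{14}\\ \beta_{23}&\beta_{24}\end{bmatrix}$, $X_\alpha=\begin{bmatrix}0&\alpha\\ \alpha^*&0\end{bmatrix}\in M_4(\mathbb{C})$ (in $2\times2$ blocks), $X_\beta$ likewise, and $Y\in M_4(\mathbb{C})$ the matrix with first row $(0,\delta_{12},\delta_{13},\delta_{14})$, second row $(\delta_{21},\delta_{22},\delta_{23},\delta_{24})$ and zero third and fourth rows. Define $D_0=X_\alpha\otimes e_{11}\otimes e_{11}+X_\beta\otimes e_{11}\otimes(1-e_{11})+Y\otimes e_{12}\otimes e_{11}+Y^*\otimes e_{21}\otimes e_{11}$, $D_1=JD_0J^{-1}$, $D_R=e_{11}\otimes(\Upsilon_R e_{21}+\overline{\Upsilon}_R e_{12})\otimes e_{11}$, and $D=D_0+D_1+D_R$. For $\xi\in\mathrm{End}_{\mathbb{C}}(H)$ set $\xi^\circ=J\xi^*J^{-1}$, and for a subset $S$ set $S^\circ=\{\xi^\circ:\xi\in S\}$ and $S'=\{\xi\in\mathrm{End}_{\mathbb{C}}(H):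 [\xi,\eta]=0\ \forall\eta\in S\}$. $\mathcal{C}\ell_D(A)$ is the complex $*$-subalgebra of $\mathrm{End}_{\mathbb{C}}(H)$ generated by $A$ and the operators $a[D,b]$, $a,b\in A$. The Hodge property means $\mathcal{C}\ell_D(A)'=\mathcal{C}\ell_D(A)^\circ$. *)

theory Defs
  imports "HOL-Analysis.Analysis"
begin

text \<open>Complex matrices of size n x m are rendered as complex^m^n (HOL-Analysis).
  Indices of M_4 are the numerals 1,2,3,4 of type 4, of M_2 the numerals 1,2 of type 2,
  of M_3 the numerals 1,2,3 of type 3 (all distinct in their types).\<close>

type_synonym m4 = "complex^4^4"
type_synonym m2 = "complex^2^2"
type_synonym m3 = "complex^3^3"

type_synonym hsp = "m4 \<times> m4"
type_synonym hop = "hsp \<Rightarrow> hsp"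

definition csc :: "complex \<Rightarrow> complex^'m^'n \<Rightarrow> complex^'m^'n" where
  "csc c M = (\<chi> i j. c * M$i$j)"

definition mconj :: "complex^'m^'n \<Rightarrow> complex^'m^'n" where
  "mconj M = (\<chi> i j. cnj (M$i$j))"

definition madj :: "complex^'n^'n \<Rightarrow> complex^'n^'n" where
  "madj M = transpose (mconj M)"

definition munit :: "'n \<Rightarrow> 'n \<Rightarrow> complex^'n^'n" where
  "munit i j = (\<chi> k l. if k = i \<and> l = j then 1 else 0)"

definition idx4 :: "4 \<Rightarrow> nat" where
  "idx4 i = (if i = 1 then 0 else if i = 2 then 1 else if i = 3 then 2 else 3)"

definition m4_of :: "complex list list \<Rightarrow> m4" where
  "m4_of rs = (\<chi> i j. rs ! idx4 i ! idx4 j)"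

definition hsc :: "complex \<Rightarrow> hsp \<Rightarrow> hsp" where
  "hsc c x = (csc c (fst x), csc c (snd x))"

definition hip :: "hsp \<Rightarrow> hsp \<Rightarrow> complex" where
  "hip x y = trace (madj (fst x) ** fst y) + trace (madj (snd x) ** snd y)"

definition Jop :: "hsp \<Rightarrow> hsp" where
  "Jop x = (madj (snd x), madj (fst x))"

definition clinear_op :: "hop \<Rightarrow> bool" where
  "clinear_op f \<longleftrightarrow> (\<forall>x y. f (x + y) = f x + f y) \<and> (\<forall>c x. f (hsc c x) = hsc c (f x))"

definition opadd :: "hop \<Rightarrow> hop \<Rightarrow> hop" where
  "opadd f g = (\<lambda>x. f x + g x)"

definition opsub :: "hop \<Rightarrow> hop \<Rightarrow> hop" where
  "opsub f g = (\<lambda>x. f x - g x)"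

definition opsc :: "complex \<Rightarrow> hop \<Rightarrow> hop" where
  "opsc c f = (\<lambda>x. hsc c (f x))"

definition oadj :: "hop \<Rightarrow> hop" where
  "oadj f = (THE g. \<forall>x y. hip (f x) y = hip x (g y))"

definition oopp :: "hop \<Rightarrow> hop" where
  "oopp f = Jop \<circ> oadj f \<circ> inv Jop"

definition commutant :: "hop set \<Rightarrow> hop set" where
  "commutant S = {f. clinear_op f \<and> (\<forall>g\<in>S. f \<circ> g = g \<circ> f)}"

inductive_set star_alg_gen :: "hop set \<Rightarrow> hop set" for S where
  gen: "f \<in> S \<Longrightarrow> f \<in> star_alg_gen S"
| add: "f \<in> star_alg_gen S \<Longrightarrow> g \<in> star_alg_gen S \<Longrightarrow> opadd f g \<in> star_alg_gen S"
| mult: "f \<in> star_alg_gen S \<Longrightarrow> g \<in> star_alg_gen S \<Longrightarrow> f \<circ> g \<in> star_alg_gen S"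
| scal: "f \<in> star_alg_gen S \<Longrightarrow> opsc c f \<in> star_alg_gen S"
| adj: "f \<in> star_alg_gen S \<Longrightarrow> oadj f \<in> star_alg_gen S"

text \<open>The identification x (x) [a b; c d] (x) y of M_4 (x) M_2 (x) M_4 with End(H).\<close>
definition tens :: "m4 \<Rightarrow> m2 \<Rightarrow> m4 \<Rightarrow> hop" where
  "tens x m y = (\<lambda>(v, w).
     (x ** (csc (m$1$1) v + csc (m$1$2) w) ** transpose y,
      x ** (csc (m$2$1) v + csc (m$2$2) w) ** transpose y))"

text \<open>The algebra A = C + H + M_3(C).\<close>
definition diagA :: "complex \<Rightarrow> complex \<Rightarrow> complex \<Rightarrow> m4" where
  "diagA l z w = m4_of [[l, 0, 0, 0], [0, cnj l, 0, 0], [0, 0, z, w], [0, 0, - cnj w, cnj z]]"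

definition diagB :: "complex \<Rightarrow> m3 \<Rightarrow> m4" where
  "diagB l m = m4_of [[l, 0, 0, 0], [0, m$1$1, m$1$2, m$1$3],
                      [0, m$2$1, m$2$2, m$2$3], [0, m$3$1, m$3$2, m$3$3]]"

definition Aalg :: "hop set" where
  "Aalg = {opadd (tens (diagA l z w) (munit 1 1) (mat 1)) (tens (diagB l m) (munit 2 2) (mat 1))
           | l z w m. True}"

definition Xmat :: "complex \<Rightarrow> complex \<Rightarrow> complex \<Rightarrow> complex \<Rightarrow> m4" where
  "Xmat a13 a14 a23 a24 = m4_of [[0, 0, a13, a14], [0, 0, a23, a24],
                                 [0, 0, 0, 0], [0, 0, 0, 0]]
                         + madj (m4_of [[0, 0, a13, a14], [0, 0, a23, a24],
                                 [0, 0, 0, 0], [0, 0, 0, 0]])"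

definition Ymat :: "complex \<Rightarrow> complex \<Rightarrow> complex \<Rightarrow> complex \<Rightarrow> complex \<Rightarrow> complex \<Rightarrow> complex \<Rightarrow> m4" where
  "Ymat d12 d13 d14 d21 d22 d23 d24 =
     m4_of [[0, d12, d13, d14], [d21, d22, d23, d24], [0, 0, 0, 0], [0, 0, 0, 0]]"

definition D0 :: "complex \<Rightarrow> complex \<Rightarrow> complex \<Rightarrow> complex \<Rightarrow> complex \<Rightarrow> complex \<Rightarrow> complex \<Rightarrow> complex \<Rightarrow>
    complex \<Rightarrow> complex \<Rightarrow> complex \<Rightarrow> complex \<Rightarrow> complex \<Rightarrow> complex \<Rightarrow> complex \<Rightarrow> hop" where
  "D0 a13 a14 a23 a24 b13 b14 b23 b24 d12 d13 d14 d21 d22 d23 d24 =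
     opadd (opadd (opadd
       (tens (Xmat a13 a14 a23 a24) (munit 1 1) (munit 1 1))
       (tens (Xmat b13 b14 b23 b24) (munit 1 1) (mat 1 - munit 1 1)))
       (tens (Ymat d12 d13 d14 d21 d22 d23 d24) (munit 1 2) (munit 1 1)))
       (tens (madj (Ymat d12 d13 d14 d21 d22 d23 d24)) (munit 2 1) (munit 1 1))"

definition DR :: "complex \<Rightarrow> hop" where
  "DR u = tens (munit 1 1) (csc u (munit 2 1) + csc (cnj u) (munit 1 2)) (munit 1 1)"

definition Dop :: "complex \<Rightarrow> complex \<Rightarrow> complex \<Rightarrow> complex \<Rightarrow> complex \<Rightarrow> complex \<Rightarrow> complex \<Rightarrow> complex \<Rightarrow>
    complex \<Rightarrow> complex \<Rightarrow> complex \<Rightarrow> complex \<Rightarrow> complex \<Rightarrow> complex \<Rightarrow> complex \<Rightarrow> complex \<Rightarrow> hop" where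
  "Dop a13 a14 a23 a24 b13 b14 b23 b24 d12 d13 d14 d21 d22 d23 d24 u =
     (let D0' = D0 a13 a14 a23 a24 b13 b14 b23 b24 d12 d13 d14 d21 d22 d23 d24
      in opadd (opadd D0' (Jop \<circ> D0' \<circ> inv Jop)) (DR u))"

definition ClD :: "hop \<Rightarrow> hop set" where
  "ClD D = star_alg_gen (Aalg \<union> {a \<circ> opsub (D \<circ> b) (b \<circ> D) | a b. a \<in> Aalg \<and> b \<in> Aalg})"

definition hodge :: "hop \<Rightarrow> bool" where
  "hodge D \<longleftrightarrow> commutant (ClD D) = oopp ` (ClD D)"

end

theory Submission
  imports Defs
begin

text \<open>
  Operators on H are identified with matrices over the index set of triples ((s,i),j), where s = 1, 2 selects
  the summand v or w and (i,j) the matrix entry. Let e((s,i),j) be the corresponding basis vector. Under the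
  vanishing assumptions every operator of Cl_D(A) preserves the following decomposition and acts on it as
  M_7 + C + M_3 + M_3, with multiplicities 1, 7, 3, 3:
  (a) the span of all e(p,1) with p \<noteq> (1,1) (a single copy of C^7);
  (b) the span of e((1,1),j) for all j and of e((2,1),j) for j \<noteq> 1 (scalars);
  (c), (d) for s = 1, 2 the span of e((s,i),j) with i, j \<noteq> 1, on the index i only.
  The algebra B of all such operators satisfies B' = B\<degree>, because J exchanges (a) with (b) and (c) with (d),
  turning multiplicity indices into matrix indices. Hence Cl_D(A) = B implies the Hodge property. If the four
  conditions hold, the arrows into e((1,2),_) read off from D_0, together with A, generate all matrix units of B.
  If one of them fails, some diagonal projection that is not in B\<degree> commutes with Cl_D(A).
\<close>

section \<open>Kronecker products and matrix units\<close>

type_synonym idx = "(2 \<times> 4) \<times> 4"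

lemmas mat_entry = matrix_matrix_mult_def csc_def madj_def mconj_def transpose_def munit_def

definition kron :: "complex^'a^'a \<Rightarrow> complex^'b^'b \<Rightarrow> complex^('a\<times>'b)^('a\<times>'b)" where
  "kron X Y = (\<chi> i j. X $ fst i $ fst j * Y $ snd i $ snd j)"

lemma kron_mult: "kron X Y ** kron X' Y' = kron (X ** X') (Y ** Y')"
proof -
  have "(\<Sum>k\<in>UNIV. X $ a $ fst k * Y $ b $ snd k * (X' $ fst k $ c * Y' $ snd k $ d))
      = (\<Sum>k\<in>UNIV. X $ a $ k * X' $ k $ c) * (\<Sum>k\<in>UNIV. Y $ b $ k * Y' $ k $ d)" for a b c d
    unfolding sum_product UNIV_Times_UNIV[symmetric] sum.cartesian_product
    by (rule sum.cong) (auto simp: algebra_simps)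
  then show ?thesis
    by (simp add: vec_eq_iff kron_def matrix_matrix_mult_def)
qed

lemma madj_kron: "madj (kron X Y) = kron (madj X) (madj Y)"
  by (simp add: vec_eq_iff kron_def madj_def mconj_def transpose_def)

lemma kron_add_left: "kron (X + X') Y = kron X Y + kron X' Y"
  and kron_add_right: "kron X (Y + Y') = kron X Y + kron X Y'"
  and kron_diff_right: "kron X (Y - Y') = kron X Y - kron X Y'"
  and kron_csc_left: "kron (csc c X) Y = csc c (kron X Y)"
  by (simp_all add: vec_eq_iff kron_def csc_def algebra_simps)

lemma madj_madj [simp]: "madj (madj X) = X"
  by (simp add: vec_eq_iff mat_entry)

lemma madj_add: "madj (X + Y) = madj X + madj Y"
  by (simp add: vec_eq_iff mat_entry)

lemma madj_munit: "madj (munit i j) = munit j i"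
  by (simp add: vec_eq_iff mat_entry)

lemma csc_mult_left: "csc c X ** Y = csc c (X ** Y)"
  and csc_mult_right: "X ** csc c Y = csc c (X ** Y)"
  by (simp_all add: vec_eq_iff mat_entry sum_distrib_left algebra_simps)

lemma csc_csc: "csc c (csc d X) = csc (c * d) X"
  and csc_one [simp]: "csc 1 X = X"
  and csc_zero [simp]: "csc 0 X = 0"
  by (simp_all add: vec_eq_iff mat_entry algebra_simps)

lemma munit_entry: "munit p q $ i $ j = (if i = p \<and> j = q then 1 else 0)"
  by (simp add: munit_def)

lemma munit_mult_entry: "(munit p q ** M) $ i $ j = (if i = p then M $ q $ j else 0)"
  and mult_munit_entry: "(M ** munit p q) $ i $ j = (if j = q then M $ i $ p else 0)"
proof -
  have "(munit p q ** M) $ i $ j = (\<Sum>k\<in>UNIV. munit p q $ i $ k * M $ k $ j)"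
    by (simp add: matrix_matrix_mult_def)
  also have "\<dots> = (\<Sum>k\<in>UNIV. if k = q then (if i = p then M $ q $ j else 0) else 0)"
    by (rule sum.cong) (auto simp: munit_def)
  finally show "(munit p q ** M) $ i $ j = (if i = p then M $ q $ j else 0)"
    by simp
  have "(M ** munit p q) $ i $ j = (\<Sum>k\<in>UNIV. M $ i $ k * munit p q $ k $ j)"
    by (simp add: matrix_matrix_mult_def)
  also have "\<dots> = (\<Sum>k\<in>UNIV. if k = p then (if j = q then M $ i $ p else 0) else 0)"
    by (rule sum.cong) (auto simp: munit_def)
  finally show "(M ** munit p q) $ i $ j = (if j = q then M $ i $ p else 0)"
    by simp
qed

lemma munit_mult: "munit p q ** munit q r = munit p r"
  by (simp add: vec_eq_iff munit_mult_entry munit_entry)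

lemma munit_sandwich: "munit p p ** M ** munit q q = csc (M $ p $ q) (munit p q)"
  by (simp add: vec_eq_iff munit_mult_entry mult_munit_entry munit_entry csc_def)

section \<open>Matrices of operators on H\<close>

lemma one_neq_two [simp]: "(1::2) \<noteq> 2" "(2::2) \<noteq> 1"
  using card_2_iff[of "UNIV::2 set"] by (auto simp: UNIV_2)

definition hvec :: "hsp \<Rightarrow> complex^idx" where
  "hvec x = (\<chi> a. (if fst (fst a) = 1 then fst x else snd x) $ snd (fst a) $ snd a)"

definition unhvec :: "complex^idx \<Rightarrow> hsp" where
  "unhvec u = ((\<chi> i j. u $ ((1,i),j)), (\<chi> i j. u $ ((2,i),j)))"

definition mop :: "complex^idx^idx \<Rightarrow> hop" where
  "mop K = (\<lambda>x. unhvec (K *v hvec x))"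

lemma hvec_unhvec [simp]: "hvec (unhvec u) = u"
  using exhaust_2 by (fastforce simp: hvec_def unhvec_def vec_eq_iff)

lemma unhvec_hvec [simp]: "unhvec (hvec x) = x"
  by (simp add: hvec_def unhvec_def vec_eq_iff prod_eq_iff)

lemma hvec_add: "hvec (x + y) = hvec x + hvec y"
  and hvec_diff: "hvec (x - y) = hvec x - hvec y"
  and hvec_hsc: "hvec (hsc c x) = c *s hvec x"
  by (simp_all add: hvec_def hsc_def csc_def vec_eq_iff)

lemma hvec_inject [simp]: "hvec x = hvec y \<longleftrightarrow> x = y"
  by (metis unhvec_hvec)

lemma hvec_mop [simp]: "hvec (mop K x) = K *v hvec x"
  by (simp add: mop_def)

lemma hop_eqI: "(\<And>x. hvec (f x) = hvec (g x)) \<Longrightarrow> f = g" for f g :: hop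
  by auto

lemma mop_mult: "mop K \<circ> mop L = mop (K ** L)"
  by (rule hop_eqI) (simp add: matrix_vector_mul_assoc)

lemma mop_add: "opadd (mop K) (mop L) = mop (K + L)"
  by (rule hop_eqI) (simp add: opadd_def hvec_add matrix_vector_mult_add_rdistrib)

lemma mop_diff: "opsub (mop K) (mop L) = mop (K - L)"
  by (rule hop_eqI) (simp add: opsub_def hvec_diff matrix_vector_mult_diff_rdistrib)

lemma mop_csc: "opsc c (mop K) = mop (csc c K)"
  by (rule hop_eqI)
     (simp add: opsc_def hvec_hsc csc_def vec_eq_iff matrix_vector_mult_def sum_distrib_left algebra_simps)

lemma mop_inject [simp]: "mop K = mop L \<longleftrightarrow> K = L"
proof
  assume eq: "mop K = mop L"
  have "K *v u = L *v u" for u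
    using arg_cong[OF fun_cong[OF eq, of "unhvec u"], of hvec] by simp
  then show "K = L"
    by (simp add: matrix_eq)
qed simp

lemma clinear_mop: "clinear_op (mop K)"
  unfolding clinear_op_def
  by (intro conjI allI; subst hvec_inject[symmetric])
     (simp_all add: hvec_add hvec_hsc matrix_vector_right_distrib vector_scalar_commute)

text \<open>A commutant consists of arbitrary complex linear functions on H, so these have to be
  turned back into matrices before any entrywise argument applies.\<close>

lemma clinear_op_mopE:
  assumes "clinear_op f"
  obtains K where "f = mop K"
proof
  let ?g = "\<lambda>u. hvec (f (unhvec u))"
  have un: "unhvec (u + v) = unhvec u + unhvec v" "unhvec (c *s u) = hsc c (unhvec u)" for u v c
    by (subst hvec_inject[symmetric], simp add: hvec_add hvec_hsc)+
  have "Vector_Spaces.linear (*s) (*s) ?g"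
    using assms
    by unfold_locales (simp_all only: clinear_op_def un hvec_add hvec_hsc vec.scale_right_distrib
      vec.scale_left_distrib vec.scale_scale vec.scale_one)
  then have "matrix ?g *v u = ?g u" for u
    by (rule matrix_works)
  then show "f = mop (matrix ?g)"
    by (intro hop_eqI) simp
qed

lemma sum_idx: "(\<Sum>a\<in>UNIV. F a) = (\<Sum>i\<in>UNIV. \<Sum>j\<in>UNIV. F ((1,i),j)) + (\<Sum>i\<in>UNIV. \<Sum>j\<in>UNIV. F ((2,i),j))"
  for F :: "idx \<Rightarrow> complex"
proof -
  have "(\<Sum>a\<in>UNIV. F a) = (\<Sum>s\<in>(UNIV::2 set). \<Sum>i\<in>UNIV. \<Sum>j\<in>UNIV. F ((s,i),j))"
    unfolding sum.cartesian_product UNIV_Times_UNIV by (rule sum.reindex_bij_witness[of _ "\<lambda>(s,i,j). ((s,i),j)" "\<lambda>((s,i),j). (s,i,j)"]) auto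
  then show ?thesis by (simp add: sum_2)
qed

text \<open>The entry of \<open>x ** v ** transpose y\<close> at (i,j) is the sum of x(i,k) y(j,l)
  v(k,l). Hence y enters untransposed and acts on the column index, while m acts on the index of the
  summand, which comes first in the index triple.\<close>

lemma tens_mop: "tens x m y = mop (kron (kron m x) y)"
proof (rule hop_eqI)
  fix v
  have "hvec (tens x m y v) $ ((s,i),j) = (kron (kron m x) y *v hvec v) $ ((s,i),j)" for s i j
  proof -
    have "(x ** (csc a V + csc b W) ** transpose y) $ i $ j
        = (\<Sum>k\<in>UNIV. \<Sum>l\<in>UNIV. a * x $ i $ k * y $ j $ l * V $ k $ l)
        + (\<Sum>k\<in>UNIV. \<Sum>l\<in>UNIV. b * x $ i $ k * y $ j $ l * W $ k $ l)" for a b V W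
    proof -
      have "(x ** (csc a V + csc b W) ** transpose y) $ i $ j
          = (\<Sum>l\<in>UNIV. \<Sum>k\<in>UNIV. a * x $ i $ k * y $ j $ l * V $ k $ l + b * x $ i $ k * y $ j $ l * W $ k $ l)"
        by (simp add: matrix_matrix_mult_def csc_def transpose_def sum_distrib_left sum_distrib_right algebra_simps)
      then show ?thesis
        by (subst (asm) sum.swap) (simp add: sum.distrib)
    qed
    then show ?thesis
      using exhaust_2[of s]
      by (auto simp: tens_def split_beta hvec_def matrix_vector_mult_def kron_def sum_idx)
  qed
  then show "hvec (tens x m y v) = hvec (mop (kron (kron m x) y) v)"
    by (simp add: vec_eq_iff)
qed

lemma hip_hvec: "hip x y = (\<Sum>a\<in>UNIV. cnj (hvec x $ a) * hvec y $ a)"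
proof -
  have "trace (madj V ** W) = (\<Sum>i\<in>UNIV. \<Sum>j\<in>UNIV. cnj (V $ i $ j) * W $ i $ j)" for V W :: m4
    unfolding trace_def by (simp add: mat_entry) (rule sum.swap)
  then show ?thesis
    by (simp add: hip_def sum_idx hvec_def)
qed

lemma hip_mop: "hip (mop K x) y = hip x (mop (madj K) y)"
proof -
  have "hip (mop K x) y = (\<Sum>a\<in>UNIV. \<Sum>b\<in>UNIV. cnj (K $ a $ b) * cnj (hvec x $ b) * hvec y $ a)"
    by (simp add: hip_hvec matrix_vector_mult_def sum_distrib_right)
  also have "\<dots> = hip x (mop (madj K) y)"
    by (subst sum.swap)
       (simp add: hip_hvec matrix_vector_mult_def sum_distrib_left madj_def mconj_def transpose_def algebra_simps)
  finally show ?thesis .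
qed

lemma hip_nondegenerate:
  assumes "\<And>x. hip x y = hip x z" shows "y = z"
proof -
  have "hvec y $ a = hvec z $ a" for a
  proof -
    have "hip (unhvec (axis a 1)) v = hvec v $ a" for v
      unfolding hip_hvec by (simp add: axis_def if_distrib[of cnj] if_distrib[of "\<lambda>c. c * _"] cong: if_cong)
    then show ?thesis using assms by metis
  qed
  then show ?thesis by (simp add: vec_eq_iff flip: hvec_inject)
qed

text \<open>As \<open>oadj\<close> is a definite description, two facts are needed:
  \<open>hip_mop\<close> supplies an adjoint, and \<open>hip_nondegenerate\<close> shows that no
  other function is one.\<close>

lemma oadj_mop: "oadj (mop K) = mop (madj K)"
  unfolding oadj_def
proof (rule the_equality)
  show "\<forall>x y. hip (mop K x) y = hip x (mop (madj K) y)"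
    by (simp add: hip_mop)
next
  fix g assume "\<forall>x y. hip (mop K x) y = hip x (g y)"
  then show "g = mop (madj K)"
    by (intro ext hip_nondegenerate) (metis hip_mop)
qed

section \<open>The antilinear isometry J and the opposite of an operator\<close>

definition flip2 :: "2 \<Rightarrow> 2" where "flip2 s = (if s = 1 then 2 else 1)"

text \<open>The permutation behind J: in coordinates J is entrywise conjugation after this
  relabelling, which exchanges the summands and transposes the matrices.\<close>

definition jswap :: "idx \<Rightarrow> idx" where
  "jswap a = ((flip2 (fst (fst a)), snd a), snd (fst a))"

lemma jswap_jswap [simp]: "jswap (jswap a) = a"
  using exhaust_2[of "fst (fst a)"] by (auto simp: jswap_def flip2_def prod_eq_iff)

lemma bij_jswap: "bij jswap"
  by (rule o_bij[of jswap]) auto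

lemma Jop_Jop [simp]: "Jop (Jop x) = x"
  by (simp add: Jop_def)

lemma inv_Jop: "inv Jop = Jop"
  by (rule inv_unique_comp) auto

lemma hvec_Jop: "hvec (Jop x) $ a = cnj (hvec x $ jswap a)"
  using exhaust_2[of "fst (fst a)"]
  by (auto simp: hvec_def Jop_def jswap_def flip2_def madj_def mconj_def transpose_def)

lemma Jop_conj_mop: "Jop \<circ> mop K \<circ> inv Jop = mop (\<chi> i j. cnj (K $ jswap i $ jswap j))"
proof (rule hop_eqI)
  fix x
  have "(\<Sum>j\<in>UNIV. cnj (K $ jswap a $ j) * hvec x $ jswap j)
      = (\<Sum>j\<in>UNIV. cnj (K $ jswap a $ jswap j) * hvec x $ j)" for a
    by (subst sum.reindex_bij_betw[OF bij_jswap, symmetric]) simp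
  then show "hvec ((Jop \<circ> mop K \<circ> inv Jop) x) = hvec (mop (\<chi> i j. cnj (K $ jswap i $ jswap j)) x)"
    by (simp add: vec_eq_iff inv_Jop hvec_Jop matrix_vector_mult_def)
qed

text \<open>The conjugation in J cancels the one in the adjoint. What is left of \<xi>\<degree> is a
  transposition followed by the relabelling \<open>jswap\<close>, which is complex linear and
  reverses products.\<close>

definition opp :: "complex^idx^idx \<Rightarrow> complex^idx^idx" where
  "opp K = (\<chi> i j. K $ jswap j $ jswap i)"

lemma oopp_mop: "oopp (mop K) = mop (opp K)"
  by (simp add: oopp_def oadj_mop Jop_conj_mop opp_def madj_def mconj_def transpose_def)

lemma opp_opp [simp]: "opp (opp K) = K"
  by (simp add: opp_def vec_eq_iff)

lemma opp_mult: "opp (K ** L) = opp L ** opp K"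
proof -
  have "(\<Sum>k\<in>UNIV. K $ jswap j $ k * L $ k $ jswap i)
      = (\<Sum>k\<in>UNIV. L $ jswap k $ jswap i * K $ jswap j $ jswap k)" for i j
    by (subst sum.reindex_bij_betw[OF bij_jswap, symmetric]) (simp add: mult.commute)
  then show ?thesis
    by (simp add: opp_def vec_eq_iff matrix_matrix_mult_def)
qed

section \<open>The block algebra B\<close>

text \<open>dimrep a and mulrep a are the matrix index and the multiplicity index of the basis vector e(a) in its
  block, encoded by representatives in the index set; either of them determines the block.\<close>

definition dimrep :: "idx \<Rightarrow> idx" where
  "dimrep a = (if fst a = (1,1) \<or> fst a = (2,1) \<and> snd a \<noteq> 1 then ((1,1),1)
               else if snd a = 1 then a else (fst a, 2))"

definition mulrep :: "idx \<Rightarrow> idx" where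
  "mulrep a = dimrep (jswap a)"

lemma mulrep_jswap [simp]: "mulrep (jswap a) = dimrep a"
  and dimrep_jswap [simp]: "dimrep (jswap a) = mulrep a"
  by (simp_all add: mulrep_def)

lemma flip2_simps [simp]: "flip2 s = 1 \<longleftrightarrow> s = 2" "flip2 s = 2 \<longleftrightarrow> s = 1"
    "flip2 s = flip2 t \<longleftrightarrow> s = t" "s \<noteq> 2 \<longleftrightarrow> s = 1"
  using exhaust_2[of s] exhaust_2[of t] by (auto simp: flip2_def)

lemma mulrep_eq: "mulrep ((s,i),j) = (if s = 2 \<and> j = 1 \<or> s = 1 \<and> j = 1 \<and> i \<noteq> 1 then ((1,1),1)
    else if i = 1 then ((flip2 s, j), 1) else ((flip2 s, j), 2))"
  by (auto simp: mulrep_def dimrep_def jswap_def)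

lemma rep_inject: "dimrep a = dimrep b \<Longrightarrow> mulrep a = mulrep b \<Longrightarrow> a = b"
  by (cases a; cases b; cases "fst a"; cases "fst b")
     (auto simp: dimrep_def mulrep_eq split: if_splits)

text \<open>The values 0, 1, 2, 3 number the blocks (b), (a), (c), (d).\<close>

definition blk :: "idx \<Rightarrow> nat" where
  "blk a = (if fst a = (1,1) \<or> fst a = (2,1) \<and> snd a \<noteq> 1 then 0
            else if snd a = 1 then 1 else if fst (fst a) = 1 then 2 else 3)"

lemma dimrep_blk: "dimrep a = dimrep b \<Longrightarrow> blk a = blk b"
  by (auto simp: dimrep_def blk_def split: if_splits)

lemma mulrep_blk: "mulrep a = mulrep b \<Longrightarrow> blk a = blk b"
  by (cases a; cases b; cases "fst a"; cases "fst b")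
     (auto simp: blk_def mulrep_eq split: if_splits)

lemma blk_zero: "blk a = 0 \<Longrightarrow> dimrep a = ((1,1),1)"
  by (auto simp: blk_def dimrep_def split: if_splits)

text \<open>Together with \<open>rep_inject\<close> this says that inside each block the pairs of
  multiplicity and matrix index form a full grid, so each block is a tensor product of the two index
  spaces.\<close>

lemma rep_rectangular:
  "(\<exists>k. mulrep k = mulrep a \<and> dimrep k = dimrep b) \<longleftrightarrow> blk a = blk b"
proof
  assume "\<exists>k. mulrep k = mulrep a \<and> dimrep k = dimrep b"
  then obtain k where "mulrep k = mulrep a" "dimrep k = dimrep b" by blast
  then show "blk a = blk b"
    using dimrep_blk[of k b] mulrep_blk[of k a] by simp
next
  assume eq: "blk a = blk b"
  show "\<exists>k. mulrep k = mulrep a \<and> dimrep k = dimrep b"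
  proof (cases "blk a = 0")
    case True
    then show ?thesis using eq blk_zero by (intro exI[of _ a]) simp
  next
    case False
    obtain s i j where a: "a = ((s,i),j)" by (metis prod.exhaust)
    obtain t k l where b: "b = ((t,k),l)" by (metis prod.exhaust)
    \<comment> \<open>Outside block (b) the matrix index is carried by the first component and the
      multiplicity, if there is any, by the column. So the witness takes its first component from b
      and its column from a.\<close>
    have "mulrep ((t,k),j) = mulrep a" "dimrep ((t,k),j) = dimrep b"
      using eq False exhaust_2[of s] exhaust_2[of t] unfolding a b blk_def mulrep_eq dimrep_def
      by (auto split: if_splits)
    then show ?thesis by blast
  qed
qed

text \<open>On each block this is a matrix N tensored with the identity on multiplicities. Equal
  \<open>mulrep\<close> already forces a common block (\<open>mulrep_blk\<close>), so N at pairs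
  from different blocks is never consulted.\<close>

definition balg :: "(complex^idx^idx) set" where
  "balg = {M. \<exists>N. \<forall>i j. M $ i $ j = (if mulrep i = mulrep j then N (dimrep i) (dimrep j) else 0)}"

text \<open>A matrix unit of B, repeated along all multiplicities. It is zero unless r and s are
  representatives taken from one block.\<close>

definition bunit :: "idx \<Rightarrow> idx \<Rightarrow> complex^idx^idx" where
  "bunit r s = (\<chi> i j. if dimrep i = r \<and> dimrep j = s \<and> mulrep i = mulrep j then 1 else 0)"

lemma balgI: "(\<And>i j. M $ i $ j = (if mulrep i = mulrep j then N (dimrep i) (dimrep j) else 0)) \<Longrightarrow> M \<in> balg"
  unfolding balg_def by blast

lemma bunit_balg: "bunit r s \<in> balg"
  by (rule balgI[where N = "\<lambda>i j. if i = r \<and> j = s then 1 else 0"]) (simp add: bunit_def)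

lemma balg_add:
  assumes "M \<in> balg" "M' \<in> balg" shows "M + M' \<in> balg"
proof -
  obtain N where N: "\<And>i j. M $ i $ j = (if mulrep i = mulrep j then N (dimrep i) (dimrep j) else 0)"
    using assms(1) unfolding balg_def by blast
  obtain N' where N': "\<And>i j. M' $ i $ j = (if mulrep i = mulrep j then N' (dimrep i) (dimrep j) else 0)"
    using assms(2) unfolding balg_def by blast
  show ?thesis
    by (rule balgI[where N = "\<lambda>i j. N i j + N' i j"]) (simp add: N N')
qed

lemma balg_csc:
  assumes "M \<in> balg" shows "csc c M \<in> balg"
proof -
  obtain N where N: "\<And>i j. M $ i $ j = (if mulrep i = mulrep j then N (dimrep i) (dimrep j) else 0)"
    using assms(1) unfolding balg_def by blast
  show ?thesis
    by (rule balgI[where N = "\<lambda>i j. c * N i j"]) (simp add: N csc_def)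
qed

lemma balg_diff:
  assumes "M \<in> balg" "M' \<in> balg" shows "M - M' \<in> balg"
proof -
  obtain N where N: "\<And>i j. M $ i $ j = (if mulrep i = mulrep j then N (dimrep i) (dimrep j) else 0)"
    using assms(1) unfolding balg_def by blast
  obtain N' where N': "\<And>i j. M' $ i $ j = (if mulrep i = mulrep j then N' (dimrep i) (dimrep j) else 0)"
    using assms(2) unfolding balg_def by blast
  show ?thesis
    by (rule balgI[where N = "\<lambda>i j. N i j - N' i j"]) (simp add: N N')
qed

lemma balg_madj:
  assumes "M \<in> balg" shows "madj M \<in> balg"
proof -
  obtain N where N: "\<And>i j. M $ i $ j = (if mulrep i = mulrep j then N (dimrep i) (dimrep j) else 0)"
    using assms(1) unfolding balg_def by blast
  show ?thesis
    by (rule balgI[where N = "\<lambda>i j. cnj (N j i)"]) (simp add: N madj_def mconj_def transpose_def)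
qed

section \<open>B and its opposite as commutants of each other\<close>

lemma sum_unique:
  fixes c :: "'a::comm_monoid_add"
  assumes "\<And>k l :: 'b::finite. Q k \<Longrightarrow> Q l \<Longrightarrow> k = l"
  shows "(\<Sum>k\<in>UNIV. if Q k then c else 0) = (if \<exists>k. Q k then c else 0)"
proof (cases "\<exists>k. Q k")
  case True
  then obtain k where "Q k" ..
  then have "Q l \<longleftrightarrow> l = k" for l using assms by blast
  then show ?thesis by simp
qed simp

lemma sum_rep:
  "(\<Sum>k\<in>UNIV. if mulrep k = mulrep i \<and> dimrep k = dimrep j then c else 0) = (if blk i = blk j then c else 0)"
  for c :: complex
  unfolding rep_rectangular[symmetric]
  by (rule sum_unique, rule rep_inject) simp_all

text \<open>\<open>jswap\<close> interchanges \<open>dimrep\<close> and \<open>mulrep\<close>, so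
  \<open>opp L\<close> acts on the multiplicity index while M acts on the matrix index. In either
  product at most one middle index contributes, and by \<open>sum_rep\<close> it exists exactly when
  i and j lie in the same block.\<close>

lemma balg_commutes_opp:
  assumes "M \<in> balg" "L \<in> balg"
  shows "M ** opp L = opp L ** M"
proof -
  obtain N where N: "\<And>i j. M $ i $ j = (if mulrep i = mulrep j then N (dimrep i) (dimrep j) else 0)"
    using assms(1) unfolding balg_def by blast
  obtain N' where N': "\<And>i j. L $ i $ j = (if mulrep i = mulrep j then N' (dimrep i) (dimrep j) else 0)"
    using assms(2) unfolding balg_def by blast
  have "(M ** opp L) $ i $ j = (opp L ** M) $ i $ j" for i j
  proof -
    let ?c = "N (dimrep i) (dimrep j) * N' (mulrep j) (mulrep i)"
    have "(M ** opp L) $ i $ j = (\<Sum>k\<in>UNIV. if mulrep k = mulrep i \<and> dimrep k = dimrep j then ?c else 0)"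
      unfolding matrix_matrix_mult_def vec_lambda_beta by (rule sum.cong) (auto simp: N N' opp_def)
    also have "\<dots> = (if blk i = blk j then ?c else 0)"
      by (rule sum_rep)
    also have "\<dots> = (if blk j = blk i then ?c else 0)"
      by auto
    also have "\<dots> = (\<Sum>k\<in>UNIV. if mulrep k = mulrep j \<and> dimrep k = dimrep i then ?c else 0)"
      by (rule sum_rep[symmetric])
    also have "\<dots> = (opp L ** M) $ i $ j"
      unfolding matrix_matrix_mult_def vec_lambda_beta by (rule sum.cong) (auto simp: N N' opp_def)
    finally show ?thesis .
  qed
  then show ?thesis by (simp add: vec_eq_iff)
qed

text \<open>Commuting with the units on the diagonal kills the entries with distinct multiplicity index; the other
  units identify the remaining entries with the same pair of matrix indices.\<close>

lemma balg_of_commutes: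
  assumes "\<And>r s. M ** opp (bunit r s) = opp (bunit r s) ** M"
  shows "M \<in> balg"
proof -
  have left: "(M ** opp (bunit (mulrep j) (mulrep k))) $ i $ j = M $ i $ k"
    if "dimrep k = dimrep j" for i j k
  proof -
    have "(M ** opp (bunit (mulrep j) (mulrep k))) $ i $ j = (\<Sum>l\<in>UNIV. if l = k then M $ i $ k else 0)"
      unfolding matrix_matrix_mult_def vec_lambda_beta
    proof (rule sum.cong)
      fix l
      have "l = k \<longleftrightarrow> mulrep l = mulrep k \<and> dimrep j = dimrep l"
        using that rep_inject[of l k] by metis
      moreover have "opp (bunit (mulrep j) (mulrep k)) $ l $ j = (if mulrep l = mulrep k \<and> dimrep j = dimrep l then 1 else 0)"
        by (simp add: bunit_def opp_def)
      ultimately show "M $ i $ l * opp (bunit (mulrep j) (mulrep k)) $ l $ j = (if l = k then M $ i $ k else 0)"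
        by (cases "l = k") auto
    qed simp
    then show ?thesis by simp
  qed
  have right: "(opp (bunit (mulrep k) (mulrep i)) ** M) $ i $ j = M $ k $ j"
    if "dimrep k = dimrep i" for i j k
  proof -
    have "(opp (bunit (mulrep k) (mulrep i)) ** M) $ i $ j = (\<Sum>l\<in>UNIV. if l = k then M $ k $ j else 0)"
      unfolding matrix_matrix_mult_def vec_lambda_beta
    proof (rule sum.cong)
      fix l
      have "l = k \<longleftrightarrow> mulrep l = mulrep k \<and> dimrep l = dimrep i"
        using that rep_inject[of l k] by metis
      moreover have "opp (bunit (mulrep k) (mulrep i)) $ i $ l = (if mulrep l = mulrep k \<and> dimrep l = dimrep i then 1 else 0)"
        by (simp add: bunit_def opp_def)
      ultimately show "opp (bunit (mulrep k) (mulrep i)) $ i $ l * M $ l $ j = (if l = k then M $ k $ j else 0)"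
        by (cases "l = k") auto
    qed simp
    then show ?thesis by simp
  qed
  have zero: "M $ i $ j = 0" if "mulrep i \<noteq> mulrep j" for i j
  proof -
    have "M $ i $ j = (M ** opp (bunit (mulrep i) (mulrep i))) $ i $ j"
      using right[of i i j] by (simp add: assms)
    also have "\<dots> = 0"
      unfolding matrix_matrix_mult_def vec_lambda_beta
      by (rule sum.neutral) (use that in \<open>simp add: bunit_def opp_def\<close>)
    finally show ?thesis .
  qed
  have same: "M $ i $ j = M $ i' $ j'"
    if "mulrep i = mulrep j" "mulrep i' = mulrep j'" "dimrep i = dimrep i'" "dimrep j = dimrep j'" for i j i' j'
  proof -
    have "M $ i $ j = (opp (bunit (mulrep i) (mulrep i')) ** M) $ i' $ j"
      using right[of i i' j] that by simp
    also have "\<dots> = (M ** opp (bunit (mulrep j) (mulrep j'))) $ i' $ j"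
      by (simp add: that assms)
    also have "\<dots> = M $ i' $ j'"
      using left[of j' j i'] that by simp
    finally show ?thesis .
  qed
  \<comment> \<open>The value may be read off at any pair of positions with matrix indices r and s
    and equal multiplicity; \<open>same\<close> shows that the choice does not matter.\<close>
  define N where
    "N r s = (SOME x. \<exists>i j. dimrep i = r \<and> dimrep j = s \<and> mulrep i = mulrep j \<and> x = M $ i $ j)" for r s
  have N: "N (dimrep i) (dimrep j) = M $ i $ j" if "mulrep i = mulrep j" for i j
    unfolding N_def
  proof (rule some_equality)
    show "\<exists>i' j'. dimrep i' = dimrep i \<and> dimrep j' = dimrep j \<and> mulrep i' = mulrep j' \<and> M $ i $ j = M $ i' $ j'"
      by (rule exI[of _ i], rule exI[of _ j]) (simp add: that)
  next
    fix x
    assume "\<exists>i' j'. dimrep i' = dimrep i \<and> dimrep j' = dimrep j \<and> mulrep i' = mulrep j' \<and> x = M $ i' $ j'"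
    then obtain i' j' where "dimrep i' = dimrep i" "dimrep j' = dimrep j" "mulrep i' = mulrep j'" "x = M $ i' $ j'"
      by (elim exE conjE)
    then show "x = M $ i $ j"
      using same[of i' j' i j] that by simp
  qed
  show ?thesis
  proof (rule balgI[where N = N])
    fix i j
    show "M $ i $ j = (if mulrep i = mulrep j then N (dimrep i) (dimrep j) else 0)"
      using zero[of i j] N[of i j] by simp
  qed
qed

text \<open>B is the set of matrices commuting with the opposite units, and commuting with a fixed
  matrix is stable under products. This replaces a computation with block sums.\<close>

lemma balg_mult:
  assumes "M \<in> balg" "M' \<in> balg" shows "M ** M' \<in> balg"
proof (rule balg_of_commutes)
  fix r s
  have "M ** M' ** opp (bunit r s) = M ** (opp (bunit r s) ** M')"
    by (simp add: balg_commutes_opp[OF assms(2) bunit_balg] flip: matrix_mul_assoc)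
  also have "\<dots> = opp (bunit r s) ** (M ** M')"
    by (simp add: balg_commutes_opp[OF assms(1) bunit_balg] matrix_mul_assoc)
  finally show "M ** M' ** opp (bunit r s) = opp (bunit r s) ** (M ** M')" .
qed

lemma commutant_balg:
  assumes "\<And>r s. M ** bunit r s = bunit r s ** M"
  shows "opp M \<in> balg"
  by (rule balg_of_commutes) (simp add: assms flip: opp_mult)

lemma balg_span:
  assumes "M \<in> balg"
    and sum: "\<And>K L. K \<in> C \<Longrightarrow> L \<in> C \<Longrightarrow> K + L \<in> C"
    and csc: "\<And>c K. K \<in> C \<Longrightarrow> csc c K \<in> C"
    and unit: "\<And>r s. bunit r s \<in> C"
  shows "M \<in> C"
proof -
  obtain N where N: "\<And>i j. M $ i $ j = (if mulrep i = mulrep j then N (dimrep i) (dimrep j) else 0)"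
    using assms(1) unfolding balg_def by blast
  have zero: "0 \<in> C"
    using csc[of _ 0] unit by (metis csc_zero)
  have sums: "sum F S \<in> C" if "finite S" "\<And>x. x \<in> S \<Longrightarrow> F x \<in> C" for F :: "idx \<times> idx \<Rightarrow> _" and S
    using that by (induction S rule: finite_induct) (simp_all add: zero sum)
  \<comment> \<open>The sum may run over all pairs of indices, because pairs that are not
    representatives of one block contribute zero units.\<close>
  have "M = (\<Sum>p\<in>UNIV. csc (N (fst p) (snd p)) (bunit (fst p) (snd p)))"
  proof -
    have "(\<Sum>p\<in>UNIV. csc (N (fst p) (snd p)) (bunit (fst p) (snd p)) $ i $ j) = M $ i $ j" for i j
    proof -
      have "(\<Sum>p\<in>UNIV. csc (N (fst p) (snd p)) (bunit (fst p) (snd p)) $ i $ j)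
        = (\<Sum>p\<in>UNIV. if p = (dimrep i, dimrep j) then M $ i $ j else 0)"
        by (rule sum.cong) (auto simp: csc_def bunit_def N)
      then show ?thesis by simp
    qed
    then show ?thesis by (simp add: vec_eq_iff)
  qed
  then show ?thesis
    using sums[of UNIV "\<lambda>p. csc (N (fst p) (snd p)) (bunit (fst p) (snd p))"] csc unit by simp
qed

text \<open>P acts in column 1 and Q in the other columns. Block (b) contains (1,1) in every column
  and (2,1) in the columns other than 1, so these positions must decouple and carry one common
  scalar; the separation of (c) from (d) forbids Q to mix the summands.\<close>

lemma balg_kron_split:
  fixes P Q :: "complex^(2\<times>4)^(2\<times>4)"
  assumes P: "\<And>q. q \<noteq> (1,1) \<Longrightarrow> P $ (1,1) $ q = 0 \<and> P $ q $ (1,1) = 0"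
    and Q1: "\<And>q. q \<noteq> (1,1) \<Longrightarrow> Q $ (1,1) $ q = 0 \<and> Q $ q $ (1,1) = 0"
    and Q2: "\<And>q. q \<noteq> (2,1) \<Longrightarrow> Q $ (2,1) $ q = 0 \<and> Q $ q $ (2,1) = 0"
    and Q: "\<And>i k. Q $ (1,i) $ (2,k) = 0 \<and> Q $ (2,k) $ (1,i) = 0"
    and eq: "Q $ (1,1) $ (1,1) = P $ (1,1) $ (1,1)" "Q $ (2,1) $ (2,1) = P $ (1,1) $ (1,1)"
  shows "kron P (munit 1 1) + kron Q (mat 1 - munit 1 1) \<in> balg" (is "?M \<in> balg")
\<comment> \<open>Representatives of (a) and (b) have column 1 and are read from P, those of (c) and
  (d) have column 2 and are read from Q.\<close>
proof (rule balgI[where N = "\<lambda>a b. if snd a = 1 then P $ fst a $ fst b else Q $ fst a $ fst b"])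
  fix a b :: idx
  obtain s i j where a: "a = ((s,i),j)" by (metis prod.exhaust)
  obtain t k l where b: "b = ((t,k),l)" by (metis prod.exhaust)
  have entry: "?M $ a $ b = (if j = l then if j = 1 then P $ (s,i) $ (t,k) else Q $ (s,i) $ (t,k) else 0)"
    by (auto simp: a b kron_def munit_def mat_def)
  consider "s = 1" "t = 1" | "s = 1" "t = 2" | "s = 2" "t = 1" | "s = 2" "t = 2"
    using exhaust_2[of s] exhaust_2[of t] by blast
  then show "?M $ a $ b = (if mulrep a = mulrep b then
      if snd (dimrep a) = 1 then P $ fst (dimrep a) $ fst (dimrep b) else Q $ fst (dimrep a) $ fst (dimrep b) else 0)"
    unfolding entry unfolding a b mulrep_eq dimrep_def
    by cases (auto simp: P Q Q1 Q2 eq)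
qed

lemma matrix_mult_add_distribs:
  fixes A B C :: "complex^'n^'n"
  shows "(A + B) ** C = A ** C + B ** C" "A ** (B + C) = A ** B + A ** C"
    "(A - B) ** C = A ** C - B ** C" "A ** (B - C) = A ** B - A ** C"
  by (simp_all add: vec_eq_iff matrix_matrix_mult_def algebra_simps sum.distrib sum_subtractf)

lemma kron_one_split: "kron X (mat 1) = kron X (munit 1 1) + kron X (mat 1 - munit 1 1)"
  by (simp flip: kron_add_right)

section \<open>The algebra A and the Dirac operator\<close>

definition alg8 :: "complex \<Rightarrow> complex \<Rightarrow> complex \<Rightarrow> m3 \<Rightarrow> complex^(2\<times>4)^(2\<times>4)" where
  "alg8 l z w m = kron (munit 1 1) (diagA l z w) + kron (munit 2 2) (diagB l m)"

definition Amat :: "(complex^idx^idx) set" where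
  "Amat = {kron (alg8 l z w m) (mat 1) | l z w m. True}"

lemma Aalg_Amat: "Aalg = mop ` Amat"
proof -
  have "Aalg = {mop (kron (alg8 l z w m) (mat 1)) | l z w m. True}"
    by (simp add: Aalg_def tens_mop mop_add alg8_def kron_add_left)
  then show ?thesis unfolding Amat_def by blast
qed

lemma alg8_entry:
  "alg8 l z w m $ (s,i) $ (t,k) = (if s = 1 \<and> t = 1 then diagA l z w $ i $ k
     else if s = 2 \<and> t = 2 then diagB l m $ i $ k else 0)"
  by (simp add: alg8_def kron_def munit_def)

lemma diagA_entry: "diagA l z w $ 1 $ k = (if k = 1 then l else 0)" "diagA l z w $ k $ 1 = (if k = 1 then l else 0)"
  "diagA l z w $ 2 $ k = (if k = 2 then cnj l else 0)" "diagA l z w $ k $ 2 = (if k = 2 then cnj l else 0)"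
  using exhaust_4[of k] by (auto simp: diagA_def m4_of_def idx4_def)

lemma diagB_entry: "diagB l m $ 1 $ k = (if k = 1 then l else 0)" "diagB l m $ k $ 1 = (if k = 1 then l else 0)"
  using exhaust_4[of k] by (auto simp: diagB_def m4_of_def idx4_def)

lemma Amat_balg:
  assumes "a \<in> Amat" shows "a \<in> balg"
proof -
  obtain l z w m where a: "a = kron (alg8 l z w m) (mat 1)"
    using assms unfolding Amat_def by blast
  show ?thesis
    unfolding a kron_one_split
    by (rule balg_kron_split) (auto simp: alg8_entry diagA_entry diagB_entry split: if_splits)
qed

text \<open>The action of D_0 within a single column: X on the first summand, Y and its adjoint
  between the two summands.\<close>

definition P8 :: "m4 \<Rightarrow> m4 \<Rightarrow> complex^(2\<times>4)^(2\<times>4)" where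
  "P8 X Y = kron (munit 1 1) X + kron (munit 1 2) Y + kron (munit 2 1) (madj Y)"

lemma P8_entry:
  "P8 X Y $ (s,i) $ (t,k) = (if s = 1 then if t = 1 then X $ i $ k else Y $ i $ k
     else if t = 1 then cnj (Y $ k $ i) else 0)"
  using exhaust_2[of s] exhaust_2[of t]
  by (auto simp: P8_def kron_def munit_def madj_def mconj_def transpose_def)

definition D0mat :: "m4 \<Rightarrow> m4 \<Rightarrow> m4 \<Rightarrow> complex^idx^idx" where
  "D0mat X X' Y = kron (P8 X Y) (munit 1 1) + kron (P8 X' 0) (mat 1 - munit 1 1)"

lemma D0_mop:
  "D0 a13 a14 a23 a24 b13 b14 b23 b24 d12 d13 d14 d21 d22 d23 d24 =
   mop (D0mat (Xmat a13 a14 a23 a24) (Xmat b13 b14 b23 b24) (Ymat d12 d13 d14 d21 d22 d23 d24))"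
proof -
  have "madj (0::m4) = 0" "\<And>X::m2. kron X (0::m4) = 0"
    by (simp_all add: vec_eq_iff madj_def mconj_def transpose_def kron_def)
  then show ?thesis
    by (simp add: D0_def tens_mop mop_add D0mat_def P8_def kron_add_left add_ac)
qed

lemma D0mat_selfadjoint:
  assumes "madj X = X" "madj X' = X'" shows "madj (D0mat X X' Y) = D0mat X X' Y"
proof -
  have m2: "madj (mat 1 - munit 1 1 :: m4) = mat 1 - munit 1 1"
    by (auto simp: vec_eq_iff madj_def mconj_def transpose_def munit_def mat_def)
  have "madj (P8 X Y) = P8 X Y" if "madj X = X" for X Y
    using that by (simp add: P8_def madj_add madj_kron madj_munit add_ac)
  then show ?thesis
    by (simp add: D0mat_def madj_add madj_kron madj_munit m2 assms)
qed

lemma madj_Xmat: "madj (Xmat a b c d) = Xmat a b c d"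
  by (simp add: Xmat_def madj_add add.commute)

lemma D0mat_balg:
  assumes "\<And>k. X $ 1 $ k = 0" "\<And>k. X $ k $ 1 = 0" "\<And>k. X' $ 1 $ k = 0" "\<And>k. X' $ k $ 1 = 0" "\<And>k. Y $ 1 $ k = 0"
  shows "D0mat X X' Y \<in> balg"
  unfolding D0mat_def by (rule balg_kron_split) (auto simp: P8_entry assms split: if_splits)

definition DRmat :: "complex \<Rightarrow> complex^idx^idx" where
  "DRmat u = kron (csc u (munit (2,1) (1,1)) + csc (cnj u) (munit (1,1) (2,1))) (munit 1 1)"

lemma kron_munit: "kron (munit a b) (munit c d) = munit (a,c) (b,d)"
  by (auto simp: vec_eq_iff kron_def munit_def)

lemma DR_mop: "DR u = mop (DRmat u)"
  by (simp add: DR_def DRmat_def tens_mop kron_munit kron_add_left kron_csc_left)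

text \<open>D_R only links the positions (1,1) and (2,1), and an element of A acts on both by the
  same \<lambda>. Therefore D_R disappears from all commutators with A.\<close>

lemma DRmat_commutes:
  assumes "a \<in> Amat" shows "DRmat u ** a = a ** DRmat u"
proof -
  obtain l z w m where a: "a = kron (alg8 l z w m) (mat 1)"
    using assms unfolding Amat_def by blast
  have "munit (s,1) (t,1) ** alg8 l z w m = alg8 l z w m ** munit (s,1) (t,1)" for s t
    using exhaust_2[of s] exhaust_2[of t]
    by (auto simp: vec_eq_iff munit_mult_entry mult_munit_entry alg8_entry diagA_entry diagB_entry)
  then show ?thesis
    by (simp add: DRmat_def a kron_mult matrix_mult_add_distribs csc_mult_left csc_mult_right)
qed

section \<open>Reduction of the Clifford algebra to matrices\<close>

definition Clgen :: "complex^idx^idx \<Rightarrow> hop set" where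
  "Clgen K = star_alg_gen (mop ` (Amat \<union> {a ** (K ** b - b ** K) | a b. a \<in> Amat \<and> b \<in> Amat}))"

text \<open>For self-adjoint K the conjugate by J is \<open>opp K\<close>, which commutes with A
  because K and A both lie in B. As D_R commutes with A too, only K survives in [D, b].\<close>

lemma ClD_Clgen:
  assumes K: "K \<in> balg" "madj K = K"
    and D: "D = opadd (opadd (mop K) (Jop \<circ> mop K \<circ> inv Jop)) (mop (DRmat u))"
  shows "ClD D = Clgen K"
proof -
  have "Jop \<circ> mop K \<circ> inv Jop = oopp (mop K)"
    by (simp add: oopp_def oadj_mop K)
  then have D: "D = mop (K + opp K + DRmat u)"
    by (simp add: D oopp_mop mop_add)
  have "opsub (D \<circ> mop b) (mop b \<circ> D) = mop (K ** b - b ** K)" if "b \<in> Amat" for b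
  proof -
    have "b ** opp K = opp K ** b"
      using that by (intro balg_commutes_opp Amat_balg K)
    then show ?thesis
      using that by (simp add: D mop_mult mop_diff matrix_mult_add_distribs DRmat_commutes)
  qed
  then have "{a \<circ> opsub (D \<circ> b) (b \<circ> D) | a b. a \<in> Aalg \<and> b \<in> Aalg}
      = mop ` {a ** (K ** b - b ** K) | a b. a \<in> Amat \<and> b \<in> Amat}"
    unfolding Aalg_Amat image_def by (auto simp: mop_mult) (metis mop_mult)+
  then show ?thesis
    by (simp add: ClD_def Clgen_def Aalg_Amat image_Un)
qed

lemma star_alg_gen_subset:
  assumes "S \<subseteq> C"
    and "\<And>K L. K \<in> C \<Longrightarrow> L \<in> C \<Longrightarrow> K + L \<in> C"
    and "\<And>K L. K \<in> C \<Longrightarrow> L \<in> C \<Longrightarrow> K ** L \<in> C"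
    and "\<And>c K. K \<in> C \<Longrightarrow> csc c K \<in> C"
    and "\<And>K. K \<in> C \<Longrightarrow> madj K \<in> C"
  shows "star_alg_gen (mop ` S) \<subseteq> mop ` C"
proof
  fix f assume "f \<in> star_alg_gen (mop ` S)"
  then show "f \<in> mop ` C"
  proof induction
    case (gen f)
    then show ?case using assms(1) by blast
  next
    case (add f g)
    then show ?case using assms(2) by (auto simp: mop_add)
  next
    case (mult f g)
    then obtain K L where "K \<in> C" "L \<in> C" "f = mop K" "g = mop L" by blast
    then show ?case using assms(3) by (simp add: mop_mult)
  next
    case (scal f c)
    then show ?case using assms(4) by (auto simp: mop_csc)
  next
    case (adj f)
    then show ?case using assms(5) by (auto simp: oadj_mop)
  qed
qed

lemma Clgen_balg:
  assumes "K \<in> balg" shows "Clgen K \<subseteq> mop ` balg"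
  unfolding Clgen_def
proof (rule star_alg_gen_subset)
  show "Amat \<union> {a ** (K ** b - b ** K) | a b. a \<in> Amat \<and> b \<in> Amat} \<subseteq> balg"
    using assms by (auto simp: Amat_balg balg_mult balg_diff)
qed (simp_all add: balg_add balg_mult balg_csc balg_madj)

section \<open>The Hodge property\<close>

text \<open>B' = B\<degree>: an operator commuting with the units of B has its opposite in B by
  \<open>commutant_balg\<close>, and the converse is \<open>balg_commutes_opp\<close>.\<close>

lemma commutant_mop_balg: "commutant (mop ` balg) = oopp ` mop ` balg"
proof
  show "commutant (mop ` balg) \<subseteq> oopp ` mop ` balg"
  proof
    fix f assume f: "f \<in> commutant (mop ` balg)"
    then have "clinear_op f" by (simp add: commutant_def)
    then obtain M where M: "f = mop M" by (rule clinear_op_mopE)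
    have "M ** bunit r s = bunit r s ** M" for r s
      using f bunit_balg[of r s] by (simp add: commutant_def M mop_mult)
    then have "opp M \<in> balg" by (rule commutant_balg)
    moreover have "f = oopp (mop (opp M))" by (simp add: M oopp_mop)
    ultimately show "f \<in> oopp ` mop ` balg" by blast
  qed
  show "oopp ` mop ` balg \<subseteq> commutant (mop ` balg)"
    by (auto simp: commutant_def oopp_mop clinear_mop mop_mult balg_commutes_opp)
qed

definition diagproj :: "('n \<Rightarrow> bool) \<Rightarrow> complex^'n^'n" where
  "diagproj d = (\<chi> i j. if i = j \<and> d i then 1 else 0)"

lemma diagproj_mult_entry: "(diagproj d ** M) $ i $ j = (if d i then M $ i $ j else 0)"
  and mult_diagproj_entry: "(M ** diagproj d) $ i $ j = (if d j then M $ i $ j else 0)"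
proof -
  have "(diagproj d ** M) $ i $ j = (\<Sum>k\<in>UNIV. if k = i then if d i then M $ i $ j else 0 else 0)"
    unfolding matrix_matrix_mult_def vec_lambda_beta diagproj_def by (rule sum.cong) auto
  then show "(diagproj d ** M) $ i $ j = (if d i then M $ i $ j else 0)" by simp
  have "(M ** diagproj d) $ i $ j = (\<Sum>k\<in>UNIV. if k = j then if d j then M $ i $ j else 0 else 0)"
    unfolding matrix_matrix_mult_def vec_lambda_beta diagproj_def by (rule sum.cong) auto
  then show "(M ** diagproj d) $ i $ j = (if d j then M $ i $ j else 0)" by simp
qed

text \<open>Under the Hodge property diagproj d lies in B\<degree>, where diagonal entries depend on mulrep only.\<close>

lemma mulrep_constant_of_hodge:
  fixes d :: "idx \<Rightarrow> bool"
  assumes sub: "C \<subseteq> mop ` balg" and hodge: "commutant C = oopp ` C"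
    and d: "\<And>M i j. mop M \<in> C \<Longrightarrow> d i \<noteq> d j \<Longrightarrow> M $ i $ j = 0"
    and eq: "mulrep i = mulrep j"
  shows "d i = d j"
proof -
  have com: "diagproj d ** M = M ** diagproj d" if "mop M \<in> C" for M
  proof -
    have "(diagproj d ** M) $ i $ j = (M ** diagproj d) $ i $ j" for i j
      using d[OF that, of i j] by (cases "d i = d j") (simp_all add: diagproj_mult_entry mult_diagproj_entry)
    then show ?thesis by (simp add: vec_eq_iff)
  qed
  have "mop (diagproj d) \<circ> g = g \<circ> mop (diagproj d)" if g: "g \<in> C" for g
  proof -
    obtain M where "g = mop M" using sub g by blast
    then show ?thesis using com g by (simp add: mop_mult)
  qed
  then have "mop (diagproj d) \<in> commutant C"
    by (simp add: commutant_def clinear_mop)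
  then obtain f where "f \<in> C" and f: "mop (diagproj d) = oopp f"
    unfolding hodge by blast
  then obtain M where "M \<in> balg" "f = mop M" using sub by blast
  then have "opp (diagproj d) \<in> balg" using f by (simp add: oopp_mop)
  then obtain N where N: "\<And>i j. opp (diagproj d) $ i $ j = (if mulrep i = mulrep j then N (dimrep i) (dimrep j) else 0)"
    unfolding balg_def by blast
  \<comment> \<open>After \<open>jswap\<close> the diagonal entries of the opposite are the values
    of d at i and j, and their matrix indices are \<open>mulrep i\<close> and
    \<open>mulrep j\<close>, which agree.\<close>
  have "opp (diagproj d) $ jswap i $ jswap i = opp (diagproj d) $ jswap j $ jswap j"
    unfolding N using eq by simp
  then show ?thesis
    by (simp add: opp_def diagproj_def split: if_splits)
qed

text \<open>The predicate d splits the basis into two parts, and the matrices respecting the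
  splitting form a *-algebra, so testing A and K is enough.\<close>

lemma Clgen_constant:
  assumes "\<And>a i j. a \<in> Amat \<Longrightarrow> d i \<noteq> d j \<Longrightarrow> a $ i $ j = 0"
    and "\<And>i j. d i \<noteq> d j \<Longrightarrow> K $ i $ j = 0"
    and "mop M \<in> Clgen K" and "d i \<noteq> d j"
  shows "M $ i $ j = 0"
proof -
  let ?C = "{M :: complex^idx^idx. \<forall>i j. d i \<noteq> d j \<longrightarrow> M $ i $ j = 0}"
  have mult: "M ** L \<in> ?C" if "M \<in> ?C" "L \<in> ?C" for M L
  proof -
    have "(M ** L) $ i $ j = 0" if "d i \<noteq> d j" for i j
      unfolding matrix_matrix_mult_def vec_lambda_beta
    proof (rule sum.neutral, rule ballI)
      fix k
      have "d i \<noteq> d k \<or> d k \<noteq> d j" using that by metis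
      then have "M $ i $ k = 0 \<or> L $ k $ j = 0"
        using \<open>M \<in> ?C\<close> \<open>L \<in> ?C\<close> by blast
      then show "M $ i $ k * L $ k $ j = 0"
        by simp
    qed
    then show ?thesis by simp
  qed
  have diff: "M - L \<in> ?C" if "M \<in> ?C" "L \<in> ?C" for M L
    using that by simp
  have A: "Amat \<subseteq> ?C" and K: "K \<in> ?C"
    using assms(1,2) by auto
  have comm: "a ** (K ** b - b ** K) \<in> ?C" if "a \<in> Amat" "b \<in> Amat" for a b
  proof -
    have "a \<in> ?C" "b \<in> ?C" using A that by blast+
    then show ?thesis using K by (intro mult diff)
  qed
  have "Clgen K \<subseteq> mop ` ?C"
    unfolding Clgen_def
  proof (rule star_alg_gen_subset)
    show "Amat \<union> {a ** (K ** b - b ** K) | a b. a \<in> Amat \<and> b \<in> Amat} \<subseteq> ?C"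
      using A comm by blast
  qed (use mult in \<open>simp_all add: csc_def madj_def mconj_def transpose_def\<close>)
  then have "mop M \<in> mop ` ?C"
    using assms(3) by (rule subsetD)
  then have "M \<in> ?C" by (simp only: image_iff mop_inject) blast
  then show ?thesis
    using assms(4) by blast
qed

lemma diagB_embed:
  fixes M :: m4
  assumes "\<And>k. M $ 1 $ k = 0" "\<And>k. M $ k $ 1 = 0"
  shows "\<exists>m. diagB 0 m = M"
proof
  \<comment> \<open>\<open>diagB\<close> puts m into rows and columns 2, 3, 4, whence the shift of
    the index by one.\<close>
  let ?e = "\<lambda>a::3. if a = 1 then 2 else if a = 2 then 3 else (4::4)"
  show "diagB 0 (\<chi> a b. M $ ?e a $ ?e b) = M"
    by (simp add: vec_eq_iff forall_4 diagB_def m4_of_def idx4_def assms)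
qed

lemma forall_idx8: "(\<forall>p::2\<times>4. R p) \<longleftrightarrow> (\<forall>i. R (1,i)) \<and> (\<forall>i. R (2,i))"
  by (simp add: split_paired_All forall_2)

text \<open>A is only a real algebra. Complex scalars make \<lambda> and its conjugate independent,
  and likewise the four entries of a quaternion.\<close>

lemma complex_span_alg8:
  assumes alg: "\<And>l z w m. kron (alg8 l z w m) (mat 1) \<in> C"
    and add: "\<And>K L. K \<in> C \<Longrightarrow> L \<in> C \<Longrightarrow> K + L \<in> C"
    and csc: "\<And>c K. K \<in> C \<Longrightarrow> csc c K \<in> C"
  shows "kron (munit (1,1) (1,1) + munit (2,1) (2,1)) (mat 1) \<in> C"
    and "kron (munit (1,2) (1,2)) (mat 1) \<in> C"
    and "i \<in> {3,4} \<Longrightarrow> k \<in> {3,4} \<Longrightarrow> kron (munit (1,i) (1,k)) (mat 1) \<in> C"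
    and "i \<noteq> 1 \<Longrightarrow> k \<noteq> 1 \<Longrightarrow> kron (munit (2,i) (2,k)) (mat 1) \<in> C"
proof -
  \<comment> \<open>If f(l) = l X + cnj(l) Y, then (f(1) - i f(i))/2 = X and (f(1) + i f(i))/2 = Y.
    The parameters below apply this to \<lambda>, z and w; the value -1 in the last use corrects the
    sign of the entry - cnj w.\<close>
  have half: "kron M (mat 1) \<in> C"
    if "M = csc (1/2) (alg8 l z w 0 + csc c (alg8 l' z' w' 0))" for M c l z w l' z' w'
    unfolding that kron_csc_left kron_add_left by (intro csc add alg)
  note entries = vec_eq_iff forall_idx8 forall_4 alg8_entry diagA_def diagB_def m4_of_def idx4_def
    munit_def csc_def
  show "kron (munit (1,1) (1,1) + munit (2,1) (2,1)) (mat 1) \<in> C"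
    by (rule half[of _ 1 0 0 "-\<i>" \<i> 0 0]) (simp add: entries)
  show "kron (munit (1,2) (1,2)) (mat 1) \<in> C"
    by (rule half[of _ 1 0 0 \<i> \<i> 0 0]) (simp add: entries)
  have "kron (munit (1,3) (1,3)) (mat 1) \<in> C"
    by (rule half[of _ 0 1 0 "-\<i>" 0 \<i> 0]) (simp add: entries)
  moreover have "kron (munit (1,4) (1,4)) (mat 1) \<in> C"
    by (rule half[of _ 0 1 0 \<i> 0 \<i> 0]) (simp add: entries)
  moreover have "kron (munit (1,3) (1,4)) (mat 1) \<in> C"
    by (rule half[of _ 0 0 1 "-\<i>" 0 0 \<i>]) (simp add: entries)
  moreover have "kron (munit (1,4) (1,3)) (mat 1) \<in> C"
    by (rule half[of _ 0 0 "-1" "-\<i>" 0 0 \<i>]) (simp add: entries)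
  ultimately show "i \<in> {3,4} \<Longrightarrow> k \<in> {3,4} \<Longrightarrow> kron (munit (1,i) (1,k)) (mat 1) \<in> C"
    by auto
  assume "i \<noteq> 1" "k \<noteq> 1"
  then have "(munit i k :: m4) $ 1 $ j = 0" "(munit i k :: m4) $ j $ 1 = 0" for j
    by (simp_all add: munit_def)
  then obtain m where m: "diagB 0 m = munit i k"
    using diagB_embed by blast
  have "diagA 0 0 0 = 0"
    by (simp add: vec_eq_iff forall_4 diagA_def m4_of_def idx4_def)
  then have "alg8 0 0 0 m = munit (2,i) (2,k)"
    by (simp add: alg8_def m kron_munit) (simp add: vec_eq_iff kron_def)
  then show "kron (munit (2,i) (2,k)) (mat 1) \<in> C"
    using alg by metis
qed

section \<open>Matrix units in the Clifford algebra\<close>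

lemma dimrep_eq_iff:
  "p \<noteq> (1,1) \<Longrightarrow> dimrep a = (p,1) \<longleftrightarrow> a = (p,1)"
  "dimrep a = ((1,1),1) \<longleftrightarrow> fst a = (1,1) \<or> fst a = (2,1) \<and> snd a \<noteq> 1"
  "snd p \<noteq> 1 \<Longrightarrow> dimrep a = (p,2) \<longleftrightarrow> fst a = p \<and> snd a \<noteq> 1"
  by (cases a; cases p; auto simp: dimrep_def)+

lemma bunit_full:
  assumes "p \<noteq> (1,1)" "q \<noteq> (1,1)"
  shows "bunit (p,1) (q,1) = kron (munit p q) (munit 1 1)"
proof -
  have "mulrep (r,1) = ((1,1),1)" if "r \<noteq> (1,1)" for r
    using that exhaust_2[of "fst r"] by (cases r) (auto simp: mulrep_eq)
  then show ?thesis
    unfolding kron_munit bunit_def dimrep_eq_iff(1)[OF assms(1)] dimrep_eq_iff(1)[OF assms(2)]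
    using assms by (auto simp: vec_eq_iff munit_def)
qed

lemma bunit_scalar:
  "bunit ((1,1),1) ((1,1),1) =
   kron (munit (1,1) (1,1)) (mat 1) + kron (munit (2,1) (2,1)) (mat 1 - munit 1 1)"
proof -
  have "bunit ((1,1),1) ((1,1),1) $ ((s,i),j) $ ((t,k),l) =
   (kron (munit (1,1) (1,1)) (mat 1) + kron (munit (2,1) (2,1)) (mat 1 - munit 1 1)) $ ((s,i),j) $ ((t,k),l)"
    for s i j t k l
    unfolding bunit_def vec_lambda_beta dimrep_eq_iff mulrep_eq
    by (auto simp: kron_def munit_def mat_def)
  then show ?thesis
    by (simp add: vec_eq_iff)
qed

lemma bunit_multiple:
  assumes "i \<noteq> 1" "k \<noteq> 1"
  shows "bunit ((s,i),2) ((s,k),2) = kron (munit (s,i) (s,k)) (mat 1 - munit 1 1)"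
proof -
  have "bunit ((s,i),2) ((s,k),2) $ ((s',i'),j) $ ((t,k'),l) =
   kron (munit (s,i) (s,k)) (mat 1 - munit 1 1) $ ((s',i'),j) $ ((t,k'),l)"
    for s' i' j t k' l
    using assms by (auto simp: bunit_def dimrep_eq_iff mulrep_eq kron_def munit_def mat_def)
  then show ?thesis
    by (simp add: vec_eq_iff)
qed

text \<open>The nonzero units, sorted by block: (b), then (a), then (c) and (d) together.\<close>

lemma bunit_cases:
  obtains "bunit r s = 0"
    | "r = ((1,1),1)" "s = ((1,1),1)"
    | p q where "p \<noteq> (1,1)" "q \<noteq> (1,1)" "r = (p,1)" "s = (q,1)"
    | t i k where "i \<noteq> 1" "k \<noteq> 1" "r = ((t,i),2)" "s = ((t,k),2)"
proof (cases "\<exists>a b. dimrep a = r \<and> dimrep b = s \<and> mulrep a = mulrep b")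
  case False
  then have "bunit r s = 0"
    by (simp add: bunit_def vec_eq_iff)
  then show ?thesis using that by blast
next
  case True
  then obtain a b where ab: "dimrep a = r" "dimrep b = s" "mulrep a = mulrep b" by blast
  have "blk a = blk b" using ab(3) by (rule mulrep_blk)
  moreover obtain s1 i j where a: "a = ((s1,i),j)" by (metis prod.exhaust)
  moreover obtain t k l where b: "b = ((t,k),l)" by (metis prod.exhaust)
  ultimately have "r = ((1,1),1) \<and> s = ((1,1),1) \<or>
      (s1,i) \<noteq> (1,1) \<and> (t,k) \<noteq> (1,1) \<and> r = ((s1,i),1) \<and> s = ((t,k),1) \<or>
      i \<noteq> 1 \<and> k \<noteq> 1 \<and> r = ((s1,i),2) \<and> s = ((s1,k),2)"
    using ab exhaust_2[of s1] exhaust_2[of t]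
    by (auto simp: blk_def dimrep_def split: if_splits)
  then show ?thesis using that by blast
qed

lemma kron_munit_mult: "kron (munit p q) Y ** kron (munit q r) Y' = kron (munit p r) (Y ** Y')"
  by (simp add: kron_mult munit_mult)

text \<open>P and Q stand for D_0 in column 1 and in the other columns. The index (1,2) serves as a
  hub: first the units in its row are found, then a product of an adjoint row unit with a row unit
  gives any unit of (a) or (c). The units of (b) and (d) follow by subtracting these from elements
  of the span of A.\<close>

lemma bunit_mem:
  fixes P Q :: "complex^(2\<times>4)^(2\<times>4)" and K :: "complex^idx^idx"
  defines "K \<equiv> kron P (munit 1 1) + kron Q (mat 1 - munit 1 1)"
  assumes add: "\<And>K L. K \<in> C \<Longrightarrow> L \<in> C \<Longrightarrow> K + L \<in> C"
    and mult: "\<And>K L. K \<in> C \<Longrightarrow> L \<in> C \<Longrightarrow> K ** L \<in> C"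
    and csc: "\<And>c K. K \<in> C \<Longrightarrow> csc c K \<in> C"
    and madj: "\<And>K. K \<in> C \<Longrightarrow> madj K \<in> C"
    and alg: "Amat \<subseteq> C"
    and comm: "\<And>b. b \<in> Amat \<Longrightarrow> K ** b - b ** K \<in> C"
    and zero: "P $ (1,2) $ (1,1) = 0" "Q $ (1,2) $ (1,1) = 0" "\<And>k. Q $ (1,2) $ (2,k) = 0"
    and d21: "P $ (1,2) $ (2,1) \<noteq> 0"
    and alpha: "\<exists>k\<in>{3,4}. P $ (1,2) $ (1,k) \<noteq> 0"
    and beta: "\<exists>k\<in>{3,4}. Q $ (1,2) $ (1,k) \<noteq> 0"
    and delta: "\<exists>k. k \<noteq> 1 \<and> P $ (1,2) $ (2,k) \<noteq> 0"
  shows "bunit r s \<in> C"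
proof -
  let ?e = "munit 1 1 :: m4" and ?f = "mat 1 - munit 1 1 :: m4" and ?h = "(1,2) :: 2 \<times> 4"
  have ef: "?e ** ?e = ?e" "?e ** ?f = 0" "?f ** ?e = 0" "?f ** ?f = ?f"
    by (simp_all add: munit_mult matrix_mult_add_distribs)
  have kron0: "kron X (0::m4) = 0" "kron (0::complex^(2\<times>4)^(2\<times>4)) Y = 0"
      "csc c (0 :: complex^idx^idx) = 0" for X :: "complex^(2\<times>4)^(2\<times>4)" and Y :: m4 and c
    by (simp_all add: vec_eq_iff kron_def csc_def)
  have diff: "M - L \<in> C" if "M \<in> C" "L \<in> C" for M L
  proof -
    have "M - L = M + csc (-1) L" by (simp add: vec_eq_iff csc_def)
    then show ?thesis using that add csc by metis
  qed
  have unscale: "M \<in> C" if "csc c M \<in> C" "c \<noteq> 0" for c M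
    using csc[OF that(1), of "1 / c"] that(2) by (simp add: csc_csc)

  \<comment> \<open>Commutators are complex linear in b, so b may range over the complex span of A.\<close>
  define AC where "AC = {b \<in> C. K ** b - b ** K \<in> C}"
  have AC_alg: "kron (alg8 l z w m) (mat 1) \<in> AC" for l z w m
    unfolding AC_def using alg comm Amat_def by blast
  have AC_add: "M + L \<in> AC" if "M \<in> AC" "L \<in> AC" for M L
  proof -
    have "K ** (M + L) - (M + L) ** K = (K ** M - M ** K) + (K ** L - L ** K)"
      by (simp add: matrix_mult_add_distribs)
    then show ?thesis using that add unfolding AC_def by simp
  qed
  have AC_csc: "csc c M \<in> AC" if "M \<in> AC" for c M
  proof -
    have "K ** csc c M - csc c M ** K = csc c (K ** M - M ** K)"
      by (simp add: csc_mult_left csc_mult_right) (simp add: csc_def vec_eq_iff algebra_simps)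
    then show ?thesis using that csc unfolding AC_def by simp
  qed
  have p1: "kron (munit (1,1) (1,1) + munit (2,1) (2,1)) (mat 1) \<in> AC"
    by (rule complex_span_alg8(1)) (fact AC_alg AC_add AC_csc)+
  have p2: "kron (munit ?h ?h) (mat 1) \<in> AC"
    by (rule complex_span_alg8(2)) (fact AC_alg AC_add AC_csc)+
  have V: "kron (munit (1,i) (1,k)) (mat 1) \<in> AC" if "i \<in> {3,4}" "k \<in> {3,4}" for i k
    by (rule complex_span_alg8(3)) (fact AC_alg AC_add AC_csc that)+
  have W: "kron (munit (2,i) (2,k)) (mat 1) \<in> AC" if "i \<noteq> 1" "k \<noteq> 1" for i k
    by (rule complex_span_alg8(4)) (fact AC_alg AC_add AC_csc that)+
  have AC: "b \<in> C" if "b \<in> AC" for b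
    using that by (simp add: AC_def)

  \<comment> \<open>Multiplying [K, X] from the left by the projection onto (1,2) removes the term X
    K, leaving row (1,2) of K cut down to the range of X.\<close>
  have corner: "kron (munit ?h ?h ** P ** X) ?e + kron (munit ?h ?h ** Q ** X) ?f \<in> C"
    if X: "kron X (mat 1) \<in> AC" and hX: "munit ?h ?h ** X = 0" for X
  proof -
    have "kron (munit ?h ?h) (mat 1) ** (K ** kron X (mat 1) - kron X (mat 1) ** K) \<in> C"
      using X p2 mult unfolding AC_def by blast
    moreover have "kron (munit ?h ?h) (mat 1) ** (kron X (mat 1) ** K) = 0"
      unfolding matrix_mul_assoc kron_mult hX kron0 by simp
    ultimately show ?thesis
      by (simp add: matrix_mult_add_distribs K_def kron_mult matrix_mul_assoc)
  qed
  have arrow: "csc (P $ ?h $ q) (kron (munit ?h q) ?e) + csc (Q $ ?h $ q) (kron (munit ?h q) ?f) \<in> C"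
    if "kron (munit q q) (mat 1) \<in> AC" "q \<noteq> ?h" for q
  proof -
    have "munit ?h ?h ** munit q q = 0"
      using that(2) by (auto simp: vec_eq_iff munit_mult_entry munit_entry)
    from corner[OF that(1) this] show ?thesis
      by (simp add: munit_sandwich kron_csc_left)
  qed

  \<comment> \<open>The span of A cannot separate (1,1) from (2,1), but three of the four resulting
    terms vanish by \<open>zero\<close>. The remaining one comes from \<delta>_21 and lives in
    column 1 only.\<close>
  have w1: "kron (munit ?h (2,1)) ?e \<in> C"
  proof -
    have "munit ?h ?h ** (munit (1,1) (1,1) + munit (2,1) (2,1)) = 0"
      by (auto simp: vec_eq_iff munit_mult_entry munit_entry)
    from corner[OF p1 this] have "csc (P $ ?h $ (2,1)) (kron (munit ?h (2,1)) ?e) \<in> C"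
      by (simp add: matrix_mult_add_distribs munit_sandwich zero kron_csc_left kron0)
    then show ?thesis using d21 by (rule unscale)
  qed
  \<comment> \<open>This unit is what distinguishes column 1 from the others; the span of A alone
    does not.\<close>
  have he: "kron (munit ?h ?h) ?e \<in> C"
    using mult[OF w1 madj[OF w1]] by (simp add: madj_kron madj_munit kron_munit_mult ef)
  have hf: "kron (munit ?h ?h) ?f \<in> C"
    using diff[OF AC[OF p2] he] by (simp flip: kron_diff_right)
  \<comment> \<open>\<open>he\<close> and \<open>hf\<close> split an arrow into its \<alpha> part
    and its \<beta> part. One nonzero coefficient suffices, since the quaternions carry its index to
    3 and 4 alike.\<close>
  have ve: "kron (munit ?h (1,k)) ?e \<in> C" and vf: "kron (munit ?h (1,k)) ?f \<in> C" if "k \<in> {3,4}" for k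
  proof -
    obtain k1 where k1: "k1 \<in> {3,4}" "P $ ?h $ (1,k1) \<noteq> 0" using alpha by blast
    have "(1,k1) \<noteq> ?h" using k1 by auto
    from mult[OF he arrow[OF V[OF k1(1) k1(1)] this]]
    have "csc (P $ ?h $ (1,k1)) (kron (munit ?h (1,k1)) ?e) \<in> C"
      by (simp add: matrix_mult_add_distribs csc_mult_right kron_munit_mult ef kron0)
    then have "kron (munit ?h (1,k1)) ?e \<in> C" using k1(2) by (rule unscale)
    from mult[OF this AC[OF V[OF k1(1) that]]] show "kron (munit ?h (1,k)) ?e \<in> C"
      by (simp add: kron_munit_mult)
    obtain k2 where k2: "k2 \<in> {3,4}" "Q $ ?h $ (1,k2) \<noteq> 0" using beta by blast
    have "(1,k2) \<noteq> ?h" using k2 by auto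
    from mult[OF hf arrow[OF V[OF k2(1) k2(1)] this]]
    have "csc (Q $ ?h $ (1,k2)) (kron (munit ?h (1,k2)) ?f) \<in> C"
      by (simp add: matrix_mult_add_distribs csc_mult_right kron_munit_mult ef kron0)
    then have "kron (munit ?h (1,k2)) ?f \<in> C" using k2(2) by (rule unscale)
    from mult[OF this AC[OF V[OF k2(1) that]]] show "kron (munit ?h (1,k)) ?f \<in> C"
      by (simp add: kron_munit_mult)
  qed
  \<comment> \<open>Here Q contributes nothing, so the arrow already lies in column 1; the M_3 part
    of A moves its index.\<close>
  have we: "kron (munit ?h (2,k)) ?e \<in> C" if "k \<noteq> 1" for k
  proof -
    obtain k1 where k1: "k1 \<noteq> 1" "P $ ?h $ (2,k1) \<noteq> 0" using delta by blast
    have "(2,k1) \<noteq> ?h" by auto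
    from arrow[OF W[OF k1(1) k1(1)] this]
    have "csc (P $ ?h $ (2,k1)) (kron (munit ?h (2,k1)) ?e) \<in> C"
      by (simp add: zero)
    then have "kron (munit ?h (2,k1)) ?e \<in> C" using k1(2) by (rule unscale)
    from mult[OF this AC[OF W[OF k1(1) that]]] show ?thesis
      by (simp add: kron_munit_mult)
  qed
  have row: "kron (munit ?h p) ?e \<in> C" if "p \<noteq> (1,1)" for p
  proof -
    obtain t k where p: "p = (t,k)" by fastforce
    have "t = 1 \<and> k = 2 \<or> t = 1 \<and> k \<in> {3,4} \<or> t = 2 \<and> k = 1 \<or> t = 2 \<and> k \<noteq> 1"
      using that exhaust_2[of t] exhaust_4[of k] by (auto simp: p)
    then show ?thesis using he ve w1 we unfolding p by metis
  qed
  have full: "kron (munit p q) ?e \<in> C" if "p \<noteq> (1,1)" "q \<noteq> (1,1)" for p q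
    using mult[OF madj[OF row[OF that(1)]] row[OF that(2)]]
    by (simp add: madj_kron madj_munit kron_munit_mult ef)
  have rowf: "kron (munit ?h (1,k)) ?f \<in> C" if "k \<noteq> 1" for k
    using that exhaust_4[of k] hf vf by auto
  have madjf: "madj ?f = ?f"
    by (auto simp: vec_eq_iff madj_def mconj_def transpose_def munit_def mat_def)
  have multiple1: "kron (munit (1,i) (1,k)) ?f \<in> C" if "i \<noteq> 1" "k \<noteq> 1" for i k
    using mult[OF madj[OF rowf[OF that(1)]] rowf[OF that(2)]]
    by (simp add: madj_kron madj_munit kron_munit_mult ef madjf)
  \<comment> \<open>M_3 acts in all columns at once; removing its column 1 part, which belongs to
    (a), leaves block (d).\<close>
  have multiple2: "kron (munit (2,i) (2,k)) ?f \<in> C" if "i \<noteq> 1" "k \<noteq> 1" for i k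
    using diff[OF AC[OF W[OF that]] full[of "(2,i)" "(2,k)"]] by (simp flip: kron_diff_right)
  have scalar: "kron (munit (1,1) (1,1)) (mat 1) + kron (munit (2,1) (2,1)) ?f \<in> C"
    using diff[OF AC[OF p1] full[of "(2,1)" "(2,1)"]]
    by (simp add: kron_add_left kron_diff_right algebra_simps)
  have "0 \<in> C"
    using csc[OF he, of 0] by simp
  show ?thesis
  proof (cases r s rule: bunit_cases)
    case 1
    then show ?thesis using \<open>0 \<in> C\<close> by simp
  next
    case 2
    then show ?thesis using scalar by (simp add: bunit_scalar)
  next
    case (3 p q)
    then show ?thesis using full by (simp add: bunit_full)
  next
    case (4 t i k)
    then show ?thesis using multiple1 multiple2 exhaust_2[of t] by (auto simp: bunit_multiple)
  qed
qed

section \<open>Application to the given Dirac operator\<close>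

lemma Clgen_closed:
  "mop M \<in> Clgen K \<Longrightarrow> mop L \<in> Clgen K \<Longrightarrow> mop (M + L) \<in> Clgen K"
  "mop M \<in> Clgen K \<Longrightarrow> mop L \<in> Clgen K \<Longrightarrow> mop (M ** L) \<in> Clgen K"
  "mop M \<in> Clgen K \<Longrightarrow> mop (csc c M) \<in> Clgen K"
  "mop M \<in> Clgen K \<Longrightarrow> mop (madj M) \<in> Clgen K"
  unfolding Clgen_def mop_add[symmetric] mop_mult[symmetric] mop_csc[symmetric] oadj_mop[symmetric]
  by (rule star_alg_gen.intros; assumption)+

lemma Clgen_gens:
  assumes "b \<in> Amat" shows "mop b \<in> Clgen K" "mop (K ** b - b ** K) \<in> Clgen K"
proof -
  show "mop b \<in> Clgen K"
    unfolding Clgen_def by (rule star_alg_gen.gen) (use assms in blast)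
  \<comment> \<open>A is unital, so taking a = 1 in a[K, b] yields the bare commutator.\<close>
  have "alg8 1 1 0 (mat 1) = mat 1"
    by (simp add: vec_eq_iff forall_idx8 forall_4 alg8_entry diagA_def diagB_def m4_of_def idx4_def mat_def)
  then have "kron (mat 1 :: complex^(2\<times>4)^(2\<times>4)) (mat 1 :: m4) \<in> Amat"
    unfolding Amat_def by (metis (mono_tags, lifting) mem_Collect_eq)
  moreover have "kron (mat 1 :: complex^(2\<times>4)^(2\<times>4)) (mat 1 :: m4) = mat 1"
    by (auto simp: vec_eq_iff kron_def mat_def prod_eq_iff)
  ultimately have one: "mat 1 \<in> Amat" by simp
  have "mop (mat 1 ** (K ** b - b ** K)) \<in> Clgen K"
    unfolding Clgen_def by (rule star_alg_gen.gen) (use assms one in blast)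
  then show "mop (K ** b - b ** K) \<in> Clgen K" by simp
qed

text \<open>The form of the obstruction used in the criterion: a set of basis vectors that A and K
  leave separate from the rest must be a union of classes of \<open>mulrep\<close>.\<close>

lemma Clgen_split_constant:
  fixes d :: "idx \<Rightarrow> bool"
  assumes K: "K = kron P (munit 1 1) + kron Q (mat 1 - munit 1 1)" "K \<in> balg"
    and hodge: "commutant (Clgen K) = oopp ` Clgen K"
    and A: "\<And>l z w m p q j. d (p,j) \<noteq> d (q,j) \<Longrightarrow> alg8 l z w m $ p $ q = 0"
    and P: "\<And>p q. d (p,1) \<noteq> d (q,1) \<Longrightarrow> P $ p $ q = 0"
    and Q: "\<And>p q j. j \<noteq> 1 \<Longrightarrow> d (p,j) \<noteq> d (q,j) \<Longrightarrow> Q $ p $ q = 0"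
    and eq: "mulrep a = mulrep b"
  shows "d a = d b"
proof (rule mulrep_constant_of_hodge[OF Clgen_balg[OF K(2)] hodge _ eq])
  fix M i j
  assume M: "mop M \<in> Clgen K" "d i \<noteq> d j"
  show "M $ i $ j = 0"
  proof (rule Clgen_constant[OF _ _ M])
    fix a i j assume a: "a \<in> Amat" and d: "d i \<noteq> d j"
    obtain l z w m where a: "a = kron (alg8 l z w m) (mat 1)"
      using a unfolding Amat_def by blast
    show "a $ i $ j = 0"
      using A[of "fst i" "snd i" "fst j" l z w m] d prod.collapse[of i] prod.collapse[of j]
      by (cases "snd i = snd j") (simp_all add: a kron_def mat_def)
  next
    fix i j assume d: "d i \<noteq> d j"
    show "K $ i $ j = 0"
      using P[of "fst i" "fst j"] Q[of "snd i" "fst i" "fst j"] d prod.collapse[of i] prod.collapse[of j]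
      by (cases "snd i = snd j"; cases "snd i = 1") (simp_all add: K kron_def mat_def munit_def)
  qed
qed

lemma Xmat_entry:
  "Xmat 0 0 c d $ 1 $ k = 0" "Xmat 0 0 c d $ k $ 1 = 0"
  "Xmat 0 0 c d $ 2 $ 3 = c" "Xmat 0 0 c d $ 2 $ 4 = d"
  using exhaust_4[of k]
  by (auto simp: Xmat_def madj_def mconj_def transpose_def m4_of_def idx4_def)

lemma Ymat_entry:
  "Ymat 0 0 0 d21 d22 d23 d24 $ 1 $ k = 0" "Ymat 0 0 0 d21 d22 d23 d24 $ 2 $ 1 = d21"
  "Ymat 0 0 0 d21 d22 d23 d24 $ 2 $ 2 = d22" "Ymat 0 0 0 d21 d22 d23 d24 $ 2 $ 3 = d23"
  "Ymat 0 0 0 d21 d22 d23 d24 $ 2 $ 4 = d24"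
  "Ymat 0 0 0 d21 d22 d23 d24 $ 3 $ k = 0" "Ymat 0 0 0 d21 d22 d23 d24 $ 4 $ k = 0"
  using exhaust_4[of k] by (auto simp: Ymat_def m4_of_def idx4_def)

lemma ClD_Dop:
  assumes K: "K = D0mat (Xmat 0 0 a23 a24) (Xmat 0 0 b23 b24) (Ymat 0 0 0 d21 d22 d23 d24)"
  shows "ClD (Dop 0 0 a23 a24 0 0 b23 b24 0 0 0 d21 d22 d23 d24 u) = Clgen K" and "K \<in> balg"
proof -
  show "K \<in> balg"
    unfolding K by (rule D0mat_balg) (simp_all add: Xmat_entry Ymat_entry)
  then show "ClD (Dop 0 0 a23 a24 0 0 b23 b24 0 0 0 d21 d22 d23 d24 u) = Clgen K"
    by (rule ClD_Clgen[where u = u]) (simp_all add: K Dop_def Let_def D0_mop DR_mop D0mat_selfadjoint madj_Xmat)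
qed

theorem theorem19:
  fixes a13 a14 a23 a24 b13 b14 b23 b24 d12 d13 d14 d21 d22 d23 d24 u :: complex
  assumes "d12 = 0" and "d13 = 0" and "d14 = 0" and "b13 = 0" and "b14 = 0"
      and "a13 = 0" and "a14 = 0"
  shows "hodge (Dop a13 a14 a23 a24 b13 b14 b23 b24 d12 d13 d14 d21 d22 d23 d24 u) \<longleftrightarrow>
         (d21 \<noteq> 0 \<and> (a23, a24) \<noteq> (0, 0) \<and> (b23, b24) \<noteq> (0, 0) \<and> (d22, d23, d24) \<noteq> (0, 0, 0))"
proof -
  let ?X = "Xmat 0 0 a23 a24" and ?X' = "Xmat 0 0 b23 b24" and ?Y = "Ymat 0 0 0 d21 d22 d23 d24"
  let ?P = "P8 ?X ?Y" and ?Q = "P8 ?X' 0"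
  define K where K: "K = D0mat ?X ?X' ?Y"
  note Cl = ClD_Dop[OF K]
  have split: "K = kron ?P (munit 1 1) + kron ?Q (mat 1 - munit 1 1)"
    by (simp add: K D0mat_def)
  have "commutant (Clgen K) = oopp ` Clgen K \<longleftrightarrow>
      d21 \<noteq> 0 \<and> (a23, a24) \<noteq> (0, 0) \<and> (b23, b24) \<noteq> (0, 0) \<and> (d22, d23, d24) \<noteq> (0, 0, 0)"
  proof
    assume hodge: "commutant (Clgen K) = oopp ` Clgen K"
    note const = Clgen_split_constant[OF split Cl(2) hodge]
    note entries = alg8_entry diagA_entry diagB_entry P8_entry
    have "d21 \<noteq> 0"
    proof
      assume "d21 = 0"
      then have Y: "?Y $ k $ 1 = 0" for k
        using exhaust_4[of k] by (auto simp: Ymat_entry)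
      \<comment> \<open>In D_0 the vector e((2,1),1) is reached only through \<delta>_21. It shares
        its multiplicity index with e((1,2),1), which the projection omits.\<close>
      have "(((2,1),1) = ((2::2,1::4),1::4)) = (((1,2),1) = ((2::2,1::4),1::4))"
        by (rule const[where d = "\<lambda>a. a = ((2,1),1)"])
          (auto simp: entries Y mulrep_eq split: if_splits)
      then show False by simp
    qed
    moreover have "(a23, a24) \<noteq> (0, 0)"
    proof
      assume "(a23, a24) = (0, 0)"
      then have X: "?X = 0"
        by (simp add: vec_eq_iff Xmat_def madj_def mconj_def transpose_def m4_of_def idx4_def forall_4)
      \<comment> \<open>In column 1 the quaternionic positions (1,3) and (1,4) are tied to the
        others only by \<alpha>, since rows 3 and 4 of Y vanish.\<close>
      have d: "(\<lambda>a::idx. fst (fst a) = 1 \<and> snd (fst a) \<in> {3,4} \<and> snd a = 1) ((1,3),1)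
          = (\<lambda>a::idx. fst (fst a) = 1 \<and> snd (fst a) \<in> {3,4} \<and> snd a = 1) ((1,2),1)"
      proof (rule const)
        show "alg8 l z w m $ p $ q = 0"
          if "(fst (fst (p, j)) = 1 \<and> snd (fst (p, j)) \<in> {3,4} \<and> snd (p, j) = (1::4)) \<noteq>
              (fst (fst (q, j)) = 1 \<and> snd (fst (q, j)) \<in> {3,4} \<and> snd (q, j) = 1)" for l z w m p q j
          using that exhaust_4[of "snd p"] exhaust_4[of "snd q"]
          by (cases p; cases q) (auto simp: entries)
        show "?P $ p $ q = 0"
          if "(fst (fst (p, 1::4)) = 1 \<and> snd (fst (p, 1::4)) \<in> {3,4} \<and> snd (p, 1::4) = 1) \<noteq>
              (fst (fst (q, 1::4)) = 1 \<and> snd (fst (q, 1::4)) \<in> {3,4} \<and> snd (q, 1::4) = 1)" for p q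
          using that by (cases p; cases q) (auto simp: entries X Ymat_entry)
      qed (auto simp: mulrep_eq)
      then show False by simp
    qed
    moreover have "(b23, b24) \<noteq> (0, 0)"
    proof
      assume "(b23, b24) = (0, 0)"
      then have X: "?X' = 0"
        by (simp add: vec_eq_iff Xmat_def madj_def mconj_def transpose_def m4_of_def idx4_def forall_4)
      \<comment> \<open>In the columns other than 1 the only links from (1,2) to (1,3) and (1,4) are
        those of \<beta>.\<close>
      have "(\<lambda>a::idx. fst a = (1,2) \<and> snd a \<noteq> 1) ((1,2),2) = (\<lambda>a::idx. fst a = (1,2) \<and> snd a \<noteq> 1) ((1,3),2)"
        by (rule const) (auto simp: entries X mulrep_eq split: if_splits)
      then show False by simp
    qed
    moreover have "(d22, d23, d24) \<noteq> (0, 0, 0)"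
    proof
      assume "(d22, d23, d24) = (0, 0, 0)"
      then have Y: "?Y $ i $ k = 0" if "k \<noteq> 1" for i k
        using that exhaust_4[of i] exhaust_4[of k] by (auto simp: Ymat_entry)
      \<comment> \<open>In column 1 the positions of M_3 are linked to the rest of (a) only by the
        last three entries in the second row of Y.\<close>
      have "(\<lambda>a::idx. fst (fst a) = 2 \<and> snd (fst a) \<noteq> 1 \<and> snd a = 1) ((2,2),1)
          = (\<lambda>a::idx. fst (fst a) = 2 \<and> snd (fst a) \<noteq> 1 \<and> snd a = 1) ((2,1),1)"
        by (rule const) (auto simp: entries Y mulrep_eq split: if_splits)
      then show False by simp
    qed
    ultimately show "d21 \<noteq> 0 \<and> (a23, a24) \<noteq> (0, 0) \<and> (b23, b24) \<noteq> (0, 0) \<and> (d22, d23, d24) \<noteq> (0, 0, 0)"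
      by blast
  next
    assume nz: "d21 \<noteq> 0 \<and> (a23, a24) \<noteq> (0, 0) \<and> (b23, b24) \<noteq> (0, 0) \<and> (d22, d23, d24) \<noteq> (0, 0, 0)"
    have unit: "bunit r s \<in> {M. mop M \<in> Clgen K}" for r s
    proof (rule bunit_mem[of _ ?P ?Q])
      show "\<exists>k\<in>{3,4}. ?P $ (1,2) $ (1,k) \<noteq> 0"
        using nz by (auto simp: P8_entry Xmat_entry)
      show "\<exists>k\<in>{3,4}. ?Q $ (1,2) $ (1,k) \<noteq> 0"
        using nz by (auto simp: P8_entry Xmat_entry)
      show "\<exists>k. k \<noteq> 1 \<and> ?P $ (1,2) $ (2,k) \<noteq> 0"
      proof (rule ccontr)
        assume "\<nexists>k. k \<noteq> 1 \<and> ?P $ (1,2) $ (2,k) \<noteq> 0"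
        then have "?Y $ 2 $ k = 0" if "k \<noteq> 1" for k
          using that by (auto simp: P8_entry)
        from this[of 2] this[of 3] this[of 4] show False
          using nz by (simp add: Ymat_entry)
      qed
    qed (use nz in \<open>auto simp: P8_entry Xmat_entry Ymat_entry Clgen_closed Clgen_gens simp flip: split\<close>)
    have "mop ` balg \<subseteq> Clgen K"
    proof
      fix f assume "f \<in> mop ` balg"
      then obtain M where M: "M \<in> balg" "f = mop M" by blast
      have "M \<in> {M. mop M \<in> Clgen K}"
        by (rule balg_span[OF M(1)]) (use unit in \<open>simp_all add: Clgen_closed\<close>)
      then show "f \<in> Clgen K" by (simp add: M)
    qed
    then have "Clgen K = mop ` balg"
      using Clgen_balg[OF Cl(2)] by blast
    then show "commutant (Clgen K) = oopp ` Clgen K"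
      by (simp only: commutant_mop_balg)
  qed
  then show ?thesis
    unfolding hodge_def assms Cl(1) .
qed

end
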